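(* Let $\mathbb{C}$ be a finitely cocomplete Barr-exact unital category. Then the Galois structure $\Gamma_{\mathrm{Ab}}$, given by the reflection $\mathrm{ab}\colon\mathbb{C}\to\mathsf{Ab}(\mathbb{C})$ of $\mathbb{C}$ onto its abelian core together with the classes of regular epimorphisms in $\mathbb{C}$ and in $\mathsf{Ab}(\mathbb{C})$, is admissible.
   Context: A pointed finitely complete category $\mathbb{C}$ is unital when, for every pair of objects $A,B$, the morphisms $\langle 1_A,0\rangle\colon A\to A\times B$ and $\langle 0,1_B\rangle\colon B\to A\times B$ are jointly strongly epimorphic. An object of a unital category is abelian when it carries an internal abelian group structure (necessarily unique). $\mathsf{Ab}(\mathbb{C})$ is the full subcategory of abelian objects, called the abelian core. For $\mathbb{C}$ finitely cocomplete, regular and unital, $\mathsf{Ab}(\mathbb{C})$ is a reflective subcategory of $\mathbb{C}$, with reflector $\mathrm{ab}$ and unit $\eta^{\mathrm{ab}}$, and the inclusion preserves regular epimorphisms. Admissibility of $\Gamma_{\mathrm{Ab}}$ means: for every object $B$ of $\mathbb{C}$, the functor from the category of regular epimorphisms $X\to\mathrm{ab}(B)$ in $\mathsf{Ab}(\mathbb{C})$ (full subcategory of the slice $(\mathsf{Ab}(\mathbb{C})\downarrow\mathrm{ab}(B))$) to the category of regular epimorphisms over $B$ in $\mathbb{C}$ (full subcategory of the slice $(\mathbb{C}\downarrow B)$), which sends such a morphism to its pullback along $\eta^{\mathrm{ab}}_B\colon B\to\mathrm{ab}(B)$, is full and faithful. *)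

theory Defs
  imports Main
begin

section \<open>Categories, full subcategories, slices and functors\<close>

text \<open>
  A category is carried by a set of objects and a set of arrows; source, target, identity
  and composition are only meaningful on these sets. Composition is written in
  the usual (applicative) order.
\<close>

record ('o, 'm) cat =
  Obj :: "'o set"
  Arr :: "'m set"
  Src :: "'m \<Rightarrow> 'o"
  Tgt :: "'m \<Rightarrow> 'o"
  Idn :: "'o \<Rightarrow> 'm"
  Cmp :: "'m \<Rightarrow> 'm \<Rightarrow> 'm"  (infixr "\<cdot>\<index>" 70)

definition Hom :: "('o, 'm) cat \<Rightarrow> 'o \<Rightarrow> 'o \<Rightarrow> 'm set" where
  "Hom C A B = {f \<in> Arr C. Src C f = A \<and> Tgt C f = B}"

locale category =
  fixes C :: "('o, 'm) cat" (structure)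
  assumes Src_Obj: "f \<in> Arr C \<Longrightarrow> Src C f \<in> Obj C"
    and Tgt_Obj: "f \<in> Arr C \<Longrightarrow> Tgt C f \<in> Obj C"
    and Idn_Hom: "A \<in> Obj C \<Longrightarrow> Idn C A \<in> Hom C A A"
    and Cmp_Hom: "f \<in> Hom C A B \<Longrightarrow> g \<in> Hom C B D \<Longrightarrow> g \<cdot> f \<in> Hom C A D"
    and Idn_left: "f \<in> Hom C A B \<Longrightarrow> Idn C B \<cdot> f = f"
    and Idn_right: "f \<in> Hom C A B \<Longrightarrow> f \<cdot> Idn C A = f"
    and Cmp_assoc: "f \<in> Hom C A B \<Longrightarrow> g \<in> Hom C B D \<Longrightarrow> h \<in> Hom C D E
                      \<Longrightarrow> (h \<cdot> g) \<cdot> f = h \<cdot> (g \<cdot> f)"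

definition op_cat :: "('o, 'm) cat \<Rightarrow> ('o, 'm) cat" where
  "op_cat C = \<lparr>Obj = Obj C, Arr = Arr C, Src = Tgt C, Tgt = Src C, Idn = Idn C,
               Cmp = (\<lambda>g f. f \<cdot>\<^bsub>C\<^esub> g)\<rparr>"

definition full_subcat :: "('o, 'm) cat \<Rightarrow> ('o \<Rightarrow> bool) \<Rightarrow> ('o, 'm) cat" where
  "full_subcat C S = C\<lparr>Obj := {A \<in> Obj C. S A},
                       Arr := {f \<in> Arr C. S (Src C f) \<and> S (Tgt C f)}\<rparr>"

text \<open>
  Objects of the slice over B are the arrows with target B. An arrow from f to g is the
  triple (f, k, g) where g k = f, so that source and target can be read off.
\<close>

definition slice :: "('o, 'm) cat \<Rightarrow> 'o \<Rightarrow> ('m, 'm \<times> 'm \<times> 'm) cat" where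
  "slice C B =
    \<lparr>Obj = {f \<in> Arr C. Tgt C f = B},
     Arr = {(f, k, g). f \<in> Arr C \<and> Tgt C f = B \<and> g \<in> Arr C \<and> Tgt C g = B \<and>
                       k \<in> Hom C (Src C f) (Src C g) \<and> g \<cdot>\<^bsub>C\<^esub> k = f},
     Src = (\<lambda>(f, k, g). f),
     Tgt = (\<lambda>(f, k, g). g),
     Idn = (\<lambda>f. (f, Idn C (Src C f), f)),
     Cmp = (\<lambda>(g, l, h) (f, k, g'). (f, l \<cdot>\<^bsub>C\<^esub> k, h))\<rparr>"

record ('o1, 'm1, 'o2, 'm2) func =
  FObj :: "'o1 \<Rightarrow> 'o2"
  FArr :: "'m1 \<Rightarrow> 'm2"

definition is_functor ::
  "('o1, 'm1) cat \<Rightarrow> ('o2, 'm2) cat \<Rightarrow> ('o1, 'm1, 'o2, 'm2) func \<Rightarrow> bool" where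
  "is_functor C D F \<longleftrightarrow> category C \<and> category D \<and>
     (\<forall>A \<in> Obj C. FObj F A \<in> Obj D) \<and>
     (\<forall>A \<in> Obj C. \<forall>B \<in> Obj C. \<forall>f \<in> Hom C A B. FArr F f \<in> Hom D (FObj F A) (FObj F B)) \<and>
     (\<forall>A \<in> Obj C. FArr F (Idn C A) = Idn D (FObj F A)) \<and>
     (\<forall>A \<in> Obj C. \<forall>B \<in> Obj C. \<forall>E \<in> Obj C. \<forall>f \<in> Hom C A B. \<forall>g \<in> Hom C B E.
        FArr F (g \<cdot>\<^bsub>C\<^esub> f) = FArr F g \<cdot>\<^bsub>D\<^esub> FArr F f)"

definition full_functor ::
  "('o1, 'm1) cat \<Rightarrow> ('o2, 'm2) cat \<Rightarrow> ('o1, 'm1, 'o2, 'm2) func \<Rightarrow> bool" where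
  "full_functor C D F \<longleftrightarrow> is_functor C D F \<and>
     (\<forall>A \<in> Obj C. \<forall>B \<in> Obj C. FArr F ` Hom C A B = Hom D (FObj F A) (FObj F B))"

definition faithful_functor ::
  "('o1, 'm1) cat \<Rightarrow> ('o2, 'm2) cat \<Rightarrow> ('o1, 'm1, 'o2, 'm2) func \<Rightarrow> bool" where
  "faithful_functor C D F \<longleftrightarrow> is_functor C D F \<and>
     (\<forall>A \<in> Obj C. \<forall>B \<in> Obj C. inj_on (FArr F) (Hom C A B))"


section \<open>Finite limits and colimits\<close>

definition is_cone ::
  "('i, 'j) cat \<Rightarrow> ('o, 'm) cat \<Rightarrow> ('i, 'j, 'o, 'm) func \<Rightarrow> 'o \<Rightarrow> ('i \<Rightarrow> 'm) \<Rightarrow> bool" where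
  "is_cone J C D L \<pi> \<longleftrightarrow> L \<in> Obj C \<and>
     (\<forall>i \<in> Obj J. \<pi> i \<in> Hom C L (FObj D i)) \<and>
     (\<forall>a \<in> Arr J. FArr D a \<cdot>\<^bsub>C\<^esub> \<pi> (Src J a) = \<pi> (Tgt J a))"

definition is_limit ::
  "('i, 'j) cat \<Rightarrow> ('o, 'm) cat \<Rightarrow> ('i, 'j, 'o, 'm) func \<Rightarrow> 'o \<Rightarrow> ('i \<Rightarrow> 'm) \<Rightarrow> bool" where
  "is_limit J C D L \<pi> \<longleftrightarrow> is_cone J C D L \<pi> \<and>
     (\<forall>M \<mu>. is_cone J C D M \<mu> \<longrightarrow>
        (\<exists>!u. u \<in> Hom C M L \<and> (\<forall>i \<in> Obj J. \<pi> i \<cdot>\<^bsub>C\<^esub> u = \<mu> i)))"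

text \<open>
  Every finite category is isomorphic to one whose objects and arrows are natural numbers,
  so quantifying over such index categories covers all finite diagrams.
\<close>

definition finitely_complete :: "('o, 'm) cat \<Rightarrow> bool" where
  "finitely_complete C \<longleftrightarrow> category C \<and>
     (\<forall>(J :: (nat, nat) cat) D. finite (Obj J) \<longrightarrow> finite (Arr J) \<longrightarrow> is_functor J C D \<longrightarrow>
        (\<exists>L \<pi>. is_limit J C D L \<pi>))"

definition finitely_cocomplete :: "('o, 'm) cat \<Rightarrow> bool" where
  "finitely_cocomplete C \<longleftrightarrow> category C \<and> finitely_complete (op_cat C)"

definition terminal :: "('o, 'm) cat \<Rightarrow> 'o \<Rightarrow> bool" where
  "terminal C T \<longleftrightarrow> T \<in> Obj C \<and> (\<forall>A \<in> Obj C. \<exists>!f. f \<in> Hom C A T)"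

definition zero_object :: "('o, 'm) cat \<Rightarrow> 'o \<Rightarrow> bool" where
  "zero_object C Z \<longleftrightarrow> terminal C Z \<and> terminal (op_cat C) Z"

definition pointed :: "('o, 'm) cat \<Rightarrow> bool" where
  "pointed C \<longleftrightarrow> category C \<and> (\<exists>Z. zero_object C Z)"

definition zero_arrow :: "('o, 'm) cat \<Rightarrow> 'o \<Rightarrow> 'o \<Rightarrow> 'm \<Rightarrow> bool" where
  "zero_arrow C A B f \<longleftrightarrow>
     (\<exists>Z s t. zero_object C Z \<and> s \<in> Hom C A Z \<and> t \<in> Hom C Z B \<and> f = t \<cdot>\<^bsub>C\<^esub> s)"

definition is_product :: "('o, 'm) cat \<Rightarrow> 'o \<Rightarrow> 'o \<Rightarrow> 'o \<Rightarrow> 'm \<Rightarrow> 'm \<Rightarrow> bool" where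
  "is_product C A B P p1 p2 \<longleftrightarrow> p1 \<in> Hom C P A \<and> p2 \<in> Hom C P B \<and>
     A \<in> Obj C \<and> B \<in> Obj C \<and> P \<in> Obj C \<and>
     (\<forall>X \<in> Obj C. \<forall>f \<in> Hom C X A. \<forall>g \<in> Hom C X B.
        \<exists>!h. h \<in> Hom C X P \<and> p1 \<cdot>\<^bsub>C\<^esub> h = f \<and> p2 \<cdot>\<^bsub>C\<^esub> h = g)"

definition tuple :: "('o, 'm) cat \<Rightarrow> 'm \<Rightarrow> 'm \<Rightarrow> 'm \<Rightarrow> 'm \<Rightarrow> 'm" where
  "tuple C p1 p2 f g =
     (THE h. h \<in> Hom C (Src C f) (Src C p1) \<and> p1 \<cdot>\<^bsub>C\<^esub> h = f \<and> p2 \<cdot>\<^bsub>C\<^esub> h = g)"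

text \<open>
  The square g p = f q, where p and f are on the sides of the apex P and of X, respectively:
  p is the pullback of f along g.
\<close>

definition is_pullback :: "('o, 'm) cat \<Rightarrow> 'm \<Rightarrow> 'm \<Rightarrow> 'm \<Rightarrow> 'm \<Rightarrow> bool" where
  "is_pullback C g f p q \<longleftrightarrow> g \<in> Arr C \<and> f \<in> Arr C \<and> p \<in> Arr C \<and> q \<in> Arr C \<and>
     Tgt C g = Tgt C f \<and> Src C p = Src C q \<and> Tgt C p = Src C g \<and> Tgt C q = Src C f \<and>
     g \<cdot>\<^bsub>C\<^esub> p = f \<cdot>\<^bsub>C\<^esub> q \<and>
     (\<forall>T \<in> Obj C. \<forall>s \<in> Hom C T (Src C g). \<forall>t \<in> Hom C T (Src C f).
        g \<cdot>\<^bsub>C\<^esub> s = f \<cdot>\<^bsub>C\<^esub> t \<longrightarrow>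
        (\<exists>!u. u \<in> Hom C T (Src C p) \<and> p \<cdot>\<^bsub>C\<^esub> u = s \<and> q \<cdot>\<^bsub>C\<^esub> u = t))"

definition is_coequalizer :: "('o, 'm) cat \<Rightarrow> 'm \<Rightarrow> 'm \<Rightarrow> 'm \<Rightarrow> bool" where
  "is_coequalizer C u v q \<longleftrightarrow> u \<in> Arr C \<and> v \<in> Hom C (Src C u) (Tgt C u) \<and>
     q \<in> Arr C \<and> Src C q = Tgt C u \<and> q \<cdot>\<^bsub>C\<^esub> u = q \<cdot>\<^bsub>C\<^esub> v \<and>
     (\<forall>T \<in> Obj C. \<forall>h \<in> Hom C (Tgt C u) T. h \<cdot>\<^bsub>C\<^esub> u = h \<cdot>\<^bsub>C\<^esub> v \<longrightarrow>
        (\<exists>!k. k \<in> Hom C (Tgt C q) T \<and> k \<cdot>\<^bsub>C\<^esub> q = h))"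


section \<open>Regular and Barr-exact categories\<close>

definition mono_arrow :: "('o, 'm) cat \<Rightarrow> 'm \<Rightarrow> bool" where
  "mono_arrow C m \<longleftrightarrow> m \<in> Arr C \<and>
     (\<forall>X \<in> Obj C. \<forall>f \<in> Hom C X (Src C m). \<forall>g \<in> Hom C X (Src C m).
        m \<cdot>\<^bsub>C\<^esub> f = m \<cdot>\<^bsub>C\<^esub> g \<longrightarrow> f = g)"

definition regular_epi :: "('o, 'm) cat \<Rightarrow> 'm \<Rightarrow> bool" where
  "regular_epi C f \<longleftrightarrow> (\<exists>u v. is_coequalizer C u v f)"

definition regular_category :: "('o, 'm) cat \<Rightarrow> bool" where
  "regular_category C \<longleftrightarrow> finitely_complete C \<and>
     (\<forall>f r1 r2. is_pullback C f f r1 r2 \<longrightarrow> (\<exists>q. is_coequalizer C r1 r2 q)) \<and>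
     (\<forall>g f p q. is_pullback C g f p q \<longrightarrow> regular_epi C f \<longrightarrow> regular_epi C p)"

definition equivalence_relation :: "('o, 'm) cat \<Rightarrow> 'o \<Rightarrow> 'o \<Rightarrow> 'm \<Rightarrow> 'm \<Rightarrow> bool" where
  "equivalence_relation C X R r1 r2 \<longleftrightarrow>
     X \<in> Obj C \<and> R \<in> Obj C \<and> r1 \<in> Hom C R X \<and> r2 \<in> Hom C R X \<and>
     (\<forall>T \<in> Obj C. \<forall>f \<in> Hom C T R. \<forall>g \<in> Hom C T R.
        r1 \<cdot>\<^bsub>C\<^esub> f = r1 \<cdot>\<^bsub>C\<^esub> g \<longrightarrow> r2 \<cdot>\<^bsub>C\<^esub> f = r2 \<cdot>\<^bsub>C\<^esub> g \<longrightarrow> f = g) \<and>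
     (\<exists>d \<in> Hom C X R. r1 \<cdot>\<^bsub>C\<^esub> d = Idn C X \<and> r2 \<cdot>\<^bsub>C\<^esub> d = Idn C X) \<and>
     (\<exists>s \<in> Hom C R R. r1 \<cdot>\<^bsub>C\<^esub> s = r2 \<and> r2 \<cdot>\<^bsub>C\<^esub> s = r1) \<and>
     (\<exists>t1 t2. is_pullback C r2 r1 t1 t2 \<and>
        (\<exists>t \<in> Hom C (Src C t1) R.
           r1 \<cdot>\<^bsub>C\<^esub> t = r1 \<cdot>\<^bsub>C\<^esub> t1 \<and> r2 \<cdot>\<^bsub>C\<^esub> t = r2 \<cdot>\<^bsub>C\<^esub> t2))"

definition barr_exact :: "('o, 'm) cat \<Rightarrow> bool" where
  "barr_exact C \<longleftrightarrow> regular_category C \<and>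
     (\<forall>X R r1 r2. equivalence_relation C X R r1 r2 \<longrightarrow> (\<exists>f. is_pullback C f f r1 r2))"


section \<open>Unital categories and abelian objects\<close>

text \<open>Jointly epimorphic and orthogonal, as a pair, to every monomorphism.\<close>

definition jointly_strongly_epi :: "('o, 'm) cat \<Rightarrow> 'm \<Rightarrow> 'm \<Rightarrow> bool" where
  "jointly_strongly_epi C u v \<longleftrightarrow> u \<in> Arr C \<and> v \<in> Arr C \<and> Tgt C u = Tgt C v \<and>
     (\<forall>X \<in> Obj C. \<forall>f \<in> Hom C (Tgt C u) X. \<forall>g \<in> Hom C (Tgt C u) X.
        f \<cdot>\<^bsub>C\<^esub> u = g \<cdot>\<^bsub>C\<^esub> u \<longrightarrow> f \<cdot>\<^bsub>C\<^esub> v = g \<cdot>\<^bsub>C\<^esub> v \<longrightarrow> f = g) \<and>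
     (\<forall>m h. mono_arrow C m \<longrightarrow> h \<in> Hom C (Tgt C u) (Tgt C m) \<longrightarrow>
        (\<forall>f \<in> Hom C (Src C u) (Src C m). \<forall>g \<in> Hom C (Src C v) (Src C m).
           h \<cdot>\<^bsub>C\<^esub> u = m \<cdot>\<^bsub>C\<^esub> f \<longrightarrow> h \<cdot>\<^bsub>C\<^esub> v = m \<cdot>\<^bsub>C\<^esub> g \<longrightarrow>
           (\<exists>d \<in> Hom C (Tgt C u) (Src C m).
              m \<cdot>\<^bsub>C\<^esub> d = h \<and> d \<cdot>\<^bsub>C\<^esub> u = f \<and> d \<cdot>\<^bsub>C\<^esub> v = g)))"

definition unital :: "('o, 'm) cat \<Rightarrow> bool" where
  "unital C \<longleftrightarrow> pointed C \<and> finitely_complete C \<and>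
     (\<forall>A B P p1 p2 zAB zBA. is_product C A B P p1 p2 \<longrightarrow>
        zero_arrow C A B zAB \<longrightarrow> zero_arrow C B A zBA \<longrightarrow>
        jointly_strongly_epi C (tuple C p1 p2 (Idn C A) zAB) (tuple C p1 p2 zBA (Idn C B)))"

text \<open>
  P is the product A x A and Q is the product P x A = (A x A) x A; b is the arrow from A to
  the terminal object. The multiplication is m, the unit e and the inversion i; the equations
  are the unit laws, associativity, the inverse laws and commutativity.
\<close>

definition abelian_group_structure ::
  "('o, 'm) cat \<Rightarrow> 'o \<Rightarrow> 'm \<Rightarrow> 'm \<Rightarrow> 'm \<Rightarrow> 'm \<Rightarrow> 'm \<Rightarrow> 'm \<Rightarrow> 'm \<Rightarrow> 'm \<Rightarrow> bool" where
  "abelian_group_structure C A p1 p2 q1 q2 b m e i \<longleftrightarrow>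
     is_product C A A (Src C p1) p1 p2 \<and>
     is_product C (Src C p1) A (Src C q1) q1 q2 \<and>
     terminal C (Tgt C b) \<and> b \<in> Hom C A (Tgt C b) \<and>
     m \<in> Hom C (Src C p1) A \<and> e \<in> Hom C (Tgt C b) A \<and> i \<in> Hom C A A \<and>
     m \<cdot>\<^bsub>C\<^esub> tuple C p1 p2 (e \<cdot>\<^bsub>C\<^esub> b) (Idn C A) = Idn C A \<and>
     m \<cdot>\<^bsub>C\<^esub> tuple C p1 p2 (Idn C A) (e \<cdot>\<^bsub>C\<^esub> b) = Idn C A \<and>
     m \<cdot>\<^bsub>C\<^esub> tuple C p1 p2 (m \<cdot>\<^bsub>C\<^esub> q1) q2 =
       m \<cdot>\<^bsub>C\<^esub> tuple C p1 p2 (p1 \<cdot>\<^bsub>C\<^esub> q1) (m \<cdot>\<^bsub>C\<^esub> tuple C p1 p2 (p2 \<cdot>\<^bsub>C\<^esub> q1) q2) \<and>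
     m \<cdot>\<^bsub>C\<^esub> tuple C p1 p2 i (Idn C A) = e \<cdot>\<^bsub>C\<^esub> b \<and>
     m \<cdot>\<^bsub>C\<^esub> tuple C p1 p2 (Idn C A) i = e \<cdot>\<^bsub>C\<^esub> b \<and>
     m \<cdot>\<^bsub>C\<^esub> tuple C p1 p2 p2 p1 = m"

definition abelian_object :: "('o, 'm) cat \<Rightarrow> 'o \<Rightarrow> bool" where
  "abelian_object C A \<longleftrightarrow>
     (\<exists>p1 p2 q1 q2 b m e i. abelian_group_structure C A p1 p2 q1 q2 b m e i)"

definition Ab :: "('o, 'm) cat \<Rightarrow> ('o, 'm) cat" where
  "Ab C = full_subcat C (abelian_object C)"


section \<open>Reflections, Galois structures and admissibility\<close>

text \<open>F is left adjoint to the inclusion of the subcategory X of C, with unit eta.\<close>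

definition is_reflection ::
  "('o, 'm) cat \<Rightarrow> ('o, 'm) cat \<Rightarrow> ('o, 'm, 'o, 'm) func \<Rightarrow> ('o \<Rightarrow> 'm) \<Rightarrow> bool" where
  "is_reflection C X F \<eta> \<longleftrightarrow> is_functor C X F \<and>
     (\<forall>B \<in> Obj C. \<eta> B \<in> Hom C B (FObj F B)) \<and>
     (\<forall>A \<in> Obj C. \<forall>B \<in> Obj C. \<forall>f \<in> Hom C A B.
        FArr F f \<cdot>\<^bsub>C\<^esub> \<eta> A = \<eta> B \<cdot>\<^bsub>C\<^esub> f) \<and>
     (\<forall>B \<in> Obj C. \<forall>A \<in> Obj X. \<forall>h \<in> Hom C B A.
        \<exists>!k. k \<in> Hom X (FObj F B) A \<and> k \<cdot>\<^bsub>C\<^esub> \<eta> B = h)"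

record ('o, 'm) galois_data =
  base :: "('o, 'm) cat"
  core :: "('o, 'm) cat"
  reflector :: "('o, 'm, 'o, 'm) func"
  refl_unit :: "'o \<Rightarrow> 'm"
  base_class :: "'m \<Rightarrow> bool"
  core_class :: "'m \<Rightarrow> bool"

definition Gamma_Ab ::
  "('o, 'm) cat \<Rightarrow> ('o, 'm, 'o, 'm) func \<Rightarrow> ('o \<Rightarrow> 'm) \<Rightarrow> ('o, 'm) galois_data" where
  "Gamma_Ab C F \<eta> =
     \<lparr>base = C, core = Ab C, reflector = F, refl_unit = \<eta>,
      base_class = regular_epi C, core_class = regular_epi (Ab C)\<rparr>"

definition class_slice ::
  "('o, 'm) cat \<Rightarrow> ('m \<Rightarrow> bool) \<Rightarrow> 'o \<Rightarrow> ('m, 'm \<times> 'm \<times> 'm) cat" where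
  "class_slice C E B = full_subcat (slice C B) E"

text \<open>
  For each object f of the domain, p f is the chosen pullback of f along a fixed arrow and
  q f is the other projection.
\<close>

definition pullback_functor ::
  "('o, 'm) cat \<Rightarrow> ('m \<Rightarrow> 'm) \<Rightarrow> ('m \<Rightarrow> 'm) \<Rightarrow>
     ('m, 'm \<times> 'm \<times> 'm, 'm, 'm \<times> 'm \<times> 'm) func" where
  "pullback_functor C p q =
     \<lparr>FObj = p,
      FArr = (\<lambda>(f, k, g).
        (p f,
         (THE u. u \<in> Hom C (Src C (p f)) (Src C (p g)) \<and>
                 p g \<cdot>\<^bsub>C\<^esub> u = p f \<and> q g \<cdot>\<^bsub>C\<^esub> u = k \<cdot>\<^bsub>C\<^esub> q f),
         p g))\<rparr>"

text \<open>
  The functor in the definition of admissibility depends on a choice of pullbacks along the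
  unit; the requirement is imposed for every such choice.
\<close>

definition admissible :: "('o, 'm) galois_data \<Rightarrow> bool" where
  "admissible \<Gamma> \<longleftrightarrow>
     (\<forall>B \<in> Obj (base \<Gamma>). \<forall>p q.
        let S = class_slice (core \<Gamma>) (core_class \<Gamma>) (FObj (reflector \<Gamma>) B);
            T = class_slice (base \<Gamma>) (base_class \<Gamma>) B
        in (\<forall>f \<in> Obj S. is_pullback (base \<Gamma>) (refl_unit \<Gamma> B) f (p f) (q f)) \<longrightarrow>
           full_functor S T (pullback_functor (base \<Gamma>) p q) \<and>
           faithful_functor S T (pullback_functor (base \<Gamma>) p q))"

end

theory Submission
  imports Defs
begin

text \<open>
  Let \<open>\<eta> : B \<rightarrow> T\<close> be a reflection unit, \<open>f : X \<rightarrow> T\<close> a regular epimorphism of abelian objects, and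
  \<open>P\<close> the pullback of \<open>f\<close> along \<open>\<eta>\<close>, with projections \<open>p : P \<rightarrow> B\<close> and \<open>q : P \<rightarrow> X\<close>. Arrows over \<open>B\<close> from
  \<open>P\<close> into the pullback of \<open>g : Y \<rightarrow> T\<close> are the arrows \<open>h : P \<rightarrow> Y\<close> with \<open>g h = \<eta> p = f q\<close>. If \<open>q\<close> is
  itself a reflection unit, then every such \<open>h\<close> is \<open>k q\<close> for exactly one \<open>k\<close>, and \<open>g k = f\<close> because
  both sides agree after \<open>q\<close>; this is precisely full faithfulness. So admissibility reduces to
  \<open>pullback_of_unit_is_unit\<close>: reflection units are stable under pullback along regular epimorphisms
  of abelian objects.

  For this, let \<open>a : P \<rightarrow> A\<close> be the reflection of \<open>P\<close> and \<open>c : A \<rightarrow> X\<close> the comparison, \<open>c a = q\<close>. The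
  kernel \<open>K\<close> of \<open>f\<close> acts on the second component of \<open>P\<close>, two elements of \<open>P\<close> lie in one orbit exactly
  when \<open>p\<close> identifies them, and \<open>a\<close> turns the action into addition in \<open>A\<close>, because in a unital
  category an arrow out of \<open>P \<times> K\<close> is determined by its restrictions to \<open>P\<close> and \<open>K\<close>. Now \<open>K\<close> embeds
  into \<open>A\<close>, since it does into \<open>X\<close>, and by Barr-exactness the embedding is the kernel of some
  \<open>e : A \<rightarrow> Q\<close> with \<open>Q\<close> abelian (\<open>mono_is_normal\<close>). The arrow \<open>e a\<close> is constant on orbits, so it factors
  through \<open>B\<close> and then through \<open>T\<close>, which gives \<open>e = \<phi> f c\<close>. Whatever \<open>c\<close> kills is therefore killed by
  \<open>e\<close>, lies in \<open>K\<close>, and vanishes because \<open>K\<close> embeds into \<open>X\<close>: \<open>c\<close> is a monomorphism. Being normal in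
  turn, \<open>c\<close> is the kernel of some \<open>e'\<close>. This \<open>e'\<close> kills \<open>K\<close>, so \<open>e' = l f\<close>; and \<open>l \<eta> p = e' q = e' c a = 0\<close>
  forces \<open>l = 0\<close>. Hence \<open>e' = 0\<close>, and the identity of \<open>X\<close> factors through \<open>c\<close>, which is thus an
  isomorphism.

  The reflection itself is built in two steps: the coequalizer of the two inclusions of \<open>X\<close> into
  \<open>X \<times> X\<close> is the universal commutative object under \<open>X\<close>, and the cokernel of the diagonal of a
  commutative object is its object of formal differences. That these quotients carry the desired
  structure rests on \<open>commutative_if_add_descends\<close>. The resulting closure of abelian objects under
  regular quotients also shows that regular epimorphisms of the abelian core are regular
  epimorphisms of the whole category.

  Arrows \<open>W \<rightarrow> A\<close> are treated as generalised elements of \<open>A\<close> throughout. In a unital category a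
  multiplication with a two-sided unit is unique, associative, commutative and preserved by all
  arrows, so elements of commutative objects can be added without any choice of structure.
\<close>

section \<open>Finite limits and colimits from diagrams without compositions\<close>

text \<open>
  Vertices double as their own identity arrows, so edges have to be numbered apart from vertices.
  An edge composes with identities only.
\<close>

definition graph_cat :: "nat set \<Rightarrow> nat set \<Rightarrow> (nat \<Rightarrow> nat) \<Rightarrow> (nat \<Rightarrow> nat) \<Rightarrow> (nat, nat) cat" where
  "graph_cat V E s t =
    \<lparr>Obj = V, Arr = V \<union> E, Src = (\<lambda>a. if a \<in> V then a else s a), Tgt = (\<lambda>a. if a \<in> V then a else t a),
     Idn = (\<lambda>v. v), Cmp = (\<lambda>b a. if a \<in> V then b else a)\<rparr>"

lemma category_graph_cat:
  assumes "V \<inter> E = {}" "s ` E \<subseteq> V" "t ` E \<subseteq> V" "s ` E \<inter> t ` E = {}"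
  shows "category (graph_cat V E s t)"
proof -
  have *: "t a \<noteq> s b" if "a \<in> E" "b \<in> E" for a b using that assms(4) by blast
  have **: "a \<notin> V" "s a \<in> V" "t a \<in> V" if "a \<in> E" for a using that assms by auto
  show ?thesis
    by unfold_locales (auto simp: graph_cat_def Hom_def ** dest: * split: if_splits)
qed

text \<open>
  As no two edges compose, functoriality puts no condition on the images of the edges, and a cone has
  to commute with the edges only. Cospans and parallel pairs have this shape.
\<close>

lemma graph_limit:
  fixes C :: "('o, 'm) cat" (structure) and V E :: "nat set" and s t :: "nat \<Rightarrow> nat"
  assumes C: "finitely_complete C"
    and fin: "finite V" "finite E"
    and gr: "V \<inter> E = {}" "s ` E \<subseteq> V" "t ` E \<subseteq> V" "s ` E \<inter> t ` E = {}"
    and D: "\<And>v. v \<in> V \<Longrightarrow> d v \<in> Obj C"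
      "\<And>a. a \<in> E \<Longrightarrow> \<delta> a \<in> Hom C (d (s a)) (d (t a))"
  defines "cone \<equiv> \<lambda>L \<pi>. L \<in> Obj C \<and> (\<forall>v \<in> V. \<pi> v \<in> Hom C L (d v)) \<and>
             (\<forall>a \<in> E. \<delta> a \<cdot> \<pi> (s a) = \<pi> (t a))"
  shows "\<exists>L \<pi>. cone L \<pi> \<and> (\<forall>M \<mu>. cone M \<mu> \<longrightarrow>
           (\<exists>!u. u \<in> Hom C M L \<and> (\<forall>v \<in> V. \<pi> v \<cdot> u = \<mu> v)))"
proof -
  interpret category C using C by (simp add: finitely_complete_def)
  let ?J = "graph_cat V E s t"
  let ?D = "\<lparr>FObj = d, FArr = (\<lambda>a. if a \<in> V then Idn C (d a) else \<delta> a)\<rparr>"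
  have *: "t a \<noteq> s b" if "a \<in> E" "b \<in> E" for a b using that gr(4) by blast
  have **: "a \<notin> V" "s a \<in> V" "t a \<in> V" if "a \<in> E" for a using that gr by auto
  have J: "Obj ?J = V" "Arr ?J = V \<union> E" by (simp_all add: graph_cat_def)
  have "is_functor ?J C ?D"
    unfolding is_functor_def
    using category_graph_cat[OF gr] category_axioms Idn_Hom D
    by (auto simp: graph_cat_def Hom_def ** dest: * intro: Idn_left[symmetric] Idn_right[symmetric]
        split: if_splits)
  then have "\<exists>L \<pi>. is_limit ?J C ?D L \<pi>"
    using C fin J unfolding finitely_complete_def by simp
  moreover have "is_cone ?J C ?D L \<pi> \<longleftrightarrow> cone L \<pi>" for L \<pi>
    unfolding is_cone_def cone_def
    by (auto simp: graph_cat_def ** Idn_left)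
  ultimately show ?thesis
    unfolding is_limit_def J by simp
qed

lemma pullback_exists:
  fixes C :: "('o, 'm) cat" (structure)
  assumes C: "finitely_complete C" and f: "g \<in> Hom C A D" "f \<in> Hom C B D"
  shows "\<exists>p q. is_pullback C g f p q"
proof -
  interpret category C using C by (simp add: finitely_complete_def)
  have obj: "A \<in> Obj C" "B \<in> Obj C" "D \<in> Obj C" using f Src_Obj Tgt_Obj by (auto simp: Hom_def)
  let ?V = "{0, 1, 2 :: nat}" and ?E = "{3, 4 :: nat}"
  let ?d = "\<lambda>v :: nat. if v = 0 then A else if v = 1 then B else D"
  let ?\<delta> = "\<lambda>a :: nat. if a = 3 then g else f"
  have d: "\<And>v. v \<in> ?V \<Longrightarrow> ?d v \<in> Obj C"
      "\<And>a. a \<in> ?E \<Longrightarrow> ?\<delta> a \<in> Hom C (?d (a - 3)) (?d 2)"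
    using obj f by auto
  obtain L \<pi> where L: "L \<in> Obj C" "\<pi> 0 \<in> Hom C L A" "\<pi> 1 \<in> Hom C L B" "\<pi> 2 \<in> Hom C L D"
      "g \<cdot> \<pi> 0 = \<pi> 2" "f \<cdot> \<pi> 1 = \<pi> 2"
    and univ: "\<And>M \<mu>. \<lbrakk>M \<in> Obj C; \<mu> 0 \<in> Hom C M A; \<mu> 1 \<in> Hom C M B; \<mu> 2 \<in> Hom C M D;
         g \<cdot> \<mu> 0 = \<mu> 2; f \<cdot> \<mu> 1 = \<mu> 2\<rbrakk> \<Longrightarrow>
       \<exists>!u. u \<in> Hom C M L \<and> (\<forall>v \<in> ?V. \<pi> v \<cdot> u = \<mu> v)"
    using graph_limit[where V = ?V and E = ?E and s = "\<lambda>a. a - 3" and t = "\<lambda>_. 2"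
        and d = ?d and \<delta> = ?\<delta>,
        OF C _ _ _ _ _ _ d] by auto
  have "\<exists>!u. u \<in> Hom C T L \<and> \<pi> 0 \<cdot> u = x \<and> \<pi> 1 \<cdot> u = y"
    if "T \<in> Obj C" "x \<in> Hom C T A" "y \<in> Hom C T B" "g \<cdot> x = f \<cdot> y" for T x y
  proof -
    have "(\<pi> 0 \<cdot> u = x \<and> \<pi> 1 \<cdot> u = y) \<longleftrightarrow>
          (\<forall>v \<in> ?V. \<pi> v \<cdot> u = (if v = 0 then x else if v = 1 then y else g \<cdot> x))"
      if "u \<in> Hom C T L" for u
      using L Cmp_assoc[OF that L(2) f(1)] by auto
    with univ[of T "\<lambda>v. if v = 0 then x else if v = 1 then y else g \<cdot> x"]
    show ?thesis using that f Cmp_Hom by (auto 0 3 cong: conj_cong)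
  qed
  moreover have S: "Src C g = A" "Src C f = B" "Src C (\<pi> 0) = L" using L f by (auto simp: Hom_def)
  ultimately have "\<forall>T \<in> Obj C. \<forall>x \<in> Hom C T (Src C g). \<forall>y \<in> Hom C T (Src C f). g \<cdot> x = f \<cdot> y \<longrightarrow>
      (\<exists>!u. u \<in> Hom C T (Src C (\<pi> 0)) \<and> \<pi> 0 \<cdot> u = x \<and> \<pi> 1 \<cdot> u = y)"
    unfolding S by blast
  then have "is_pullback C g f (\<pi> 0) (\<pi> 1)"
    using L f unfolding is_pullback_def by (auto simp: Hom_def)
  then show ?thesis by blast
qed

lemma coequalizer_exists:
  fixes C :: "('o, 'm) cat" (structure)
  assumes C: "finitely_cocomplete C" and f: "u \<in> Hom C A B" "v \<in> Hom C A B"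
  shows "\<exists>q. is_coequalizer C u v q"
proof -
  interpret category C using C by (simp add: finitely_cocomplete_def)
  have obj: "A \<in> Obj C" "B \<in> Obj C" using f Src_Obj Tgt_Obj by (auto simp: Hom_def)
  have op: "Hom (op_cat C) X Y = Hom C Y X" "Obj (op_cat C) = Obj C" "y \<cdot>\<^bsub>op_cat C\<^esub> x = x \<cdot> y" for X Y x y
    by (auto simp: op_cat_def Hom_def)
  let ?V = "{0, 1 :: nat}" and ?E = "{2, 3 :: nat}"
  let ?d = "\<lambda>v :: nat. if v = 0 then B else A"
  let ?\<delta> = "\<lambda>a :: nat. if a = 2 then u else v"
  have d: "\<And>v. v \<in> ?V \<Longrightarrow> ?d v \<in> Obj (op_cat C)"
      "\<And>a. a \<in> ?E \<Longrightarrow> ?\<delta> a \<in> Hom (op_cat C) (?d 0) (?d 1)"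
    using obj f by (auto simp: op)
  have C': "finitely_complete (op_cat C)" using C by (simp add: finitely_cocomplete_def)
  obtain L \<pi> where L: "L \<in> Obj C" "\<pi> 0 \<in> Hom C B L" "\<pi> 1 \<in> Hom C A L" "\<pi> 0 \<cdot> u = \<pi> 1" "\<pi> 0 \<cdot> v = \<pi> 1"
    and univ: "\<And>M \<mu>. \<lbrakk>M \<in> Obj C; \<mu> 0 \<in> Hom C B M; \<mu> 1 \<in> Hom C A M; \<mu> 0 \<cdot> u = \<mu> 1; \<mu> 0 \<cdot> v = \<mu> 1\<rbrakk> \<Longrightarrow>
       \<exists>!k. k \<in> Hom C L M \<and> (\<forall>w \<in> ?V. k \<cdot> \<pi> w = \<mu> w)"
    using graph_limit[where V = ?V and E = ?E and s = "\<lambda>_. 0" and t = "\<lambda>_. 1"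
        and d = ?d and \<delta> = ?\<delta>,
        OF C' _ _ _ _ _ _ d] by (auto simp: op)
  have "\<exists>!k. k \<in> Hom C L T \<and> k \<cdot> \<pi> 0 = h"
    if "T \<in> Obj C" "h \<in> Hom C B T" "h \<cdot> u = h \<cdot> v" for T h
  proof -
    have "(k \<cdot> \<pi> 0 = h) \<longleftrightarrow> (\<forall>w \<in> ?V. k \<cdot> \<pi> w = (if w = 0 then h else h \<cdot> u))"
      if "k \<in> Hom C L T" for k
      using L Cmp_assoc[OF f(1) L(2) that] by auto
    with univ[of T "\<lambda>w. if w = 0 then h else h \<cdot> u"]
    show ?thesis using that f Cmp_Hom by (auto 0 3 cong: conj_cong)
  qed
  moreover have S: "Tgt C u = B" "Tgt C (\<pi> 0) = L" using L f by (auto simp: Hom_def)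
  ultimately have "\<forall>T \<in> Obj C. \<forall>h \<in> Hom C (Tgt C u) T. h \<cdot> u = h \<cdot> v \<longrightarrow>
      (\<exists>!k. k \<in> Hom C (Tgt C (\<pi> 0)) T \<and> k \<cdot> \<pi> 0 = h)"
    unfolding S by blast
  then have "is_coequalizer C u v (\<pi> 0)"
    using L f unfolding is_coequalizer_def by (auto simp: Hom_def)
  then show ?thesis by blast
qed

section \<open>Pullbacks, coequalizers and regular epimorphisms\<close>

context category
begin

lemma HomD:
  assumes "f \<in> Hom C A B"
  shows "f \<in> Arr C" "Src C f = A" "Tgt C f = B" "A \<in> Obj C" "B \<in> Obj C"
  using assms Src_Obj Tgt_Obj by (auto simp: Hom_def)

lemma hom_iff [simp]: "f \<in> Hom C A B \<longleftrightarrow> f \<in> Arr C \<and> Src C f = A \<and> Tgt C f = B"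
  by (auto simp: Hom_def)

lemma Cmp_typing [simp]:
  assumes "f \<in> Arr C" "g \<in> Arr C" "Src C g = Tgt C f"
  shows "g \<cdot> f \<in> Arr C" "Src C (g \<cdot> f) = Src C f" "Tgt C (g \<cdot> f) = Tgt C g"
  using Cmp_Hom[of f "Src C f" "Tgt C f" g "Tgt C g"] assms by auto

lemma Cmp_assoc' [simp]:
  assumes "f \<in> Arr C" "g \<in> Arr C" "h \<in> Arr C" "Src C g = Tgt C f" "Src C h = Tgt C g"
  shows "(h \<cdot> g) \<cdot> f = h \<cdot> (g \<cdot> f)"
  using Cmp_assoc[of f "Src C f" "Tgt C f" g "Tgt C g" h "Tgt C h"] assms by auto

lemma Idn_typing [simp]:
  assumes "A \<in> Obj C"
  shows "Idn C A \<in> Arr C" "Src C (Idn C A) = A" "Tgt C (Idn C A) = A"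
  using Idn_Hom[OF assms] by auto

lemma Idn_neutral [simp]:
  "f \<in> Arr C \<Longrightarrow> Tgt C f = B \<Longrightarrow> Idn C B \<cdot> f = f"
  "f \<in> Arr C \<Longrightarrow> Src C f = A \<Longrightarrow> f \<cdot> Idn C A = f"
  using Idn_left[of f "Src C f" B] Idn_right[of f A "Tgt C f"] by auto

declare Src_Obj [simp] Tgt_Obj [simp]

text \<open>
  Composites are normalised by bracketing to the right, which can hide the left-hand side of a known
  equation inside a longer composite. This rule recovers it.
\<close>

lemma Cmp_reduce:
  assumes "g \<cdot> f = h" "f \<in> Arr C" "g \<in> Arr C" "Src C g = Tgt C f" "x \<in> Arr C" "Tgt C x = Src C f"
  shows "g \<cdot> (f \<cdot> x) = h \<cdot> x"
  using Cmp_assoc'[of x f g] assms by simp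

lemma monoD:
  assumes "mono_arrow C m" "m \<cdot> f = m \<cdot> g" "f \<in> Hom C X (Src C m)" "g \<in> Hom C X (Src C m)"
  shows "f = g"
  using assms HomD(4)[OF assms(3)] unfolding mono_arrow_def by blast

lemma pullbackD:
  assumes "is_pullback C g f p q"
  shows "g \<in> Arr C" "f \<in> Arr C" "p \<in> Arr C" "q \<in> Arr C" "Tgt C f = Tgt C g" "Src C q = Src C p"
    "Tgt C p = Src C g" "Tgt C q = Src C f" "f \<cdot> q = g \<cdot> p"
  using assms unfolding is_pullback_def by auto

lemma pullback_lift:
  assumes "is_pullback C g f p q" "s \<in> Hom C T (Src C g)" "t \<in> Hom C T (Src C f)" "g \<cdot> s = f \<cdot> t"
  obtains u where "u \<in> Hom C T (Src C p)" "p \<cdot> u = s" "q \<cdot> u = t"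
  using assms HomD(4)[OF assms(2)] unfolding is_pullback_def by blast

lemma pullback_ext:
  assumes pb: "is_pullback C g f p q"
    and u: "u \<in> Hom C T (Src C p)" "v \<in> Hom C T (Src C p)" and eq: "p \<cdot> u = p \<cdot> v" "q \<cdot> u = q \<cdot> v"
  shows "u = v"
proof -
  note [simp] = HomD[OF u(1)] HomD[OF u(2)] pullbackD[OF pb]
  have "g \<cdot> (p \<cdot> v) = f \<cdot> (q \<cdot> v)"
    using Cmp_reduce[OF pullbackD(9)[OF pb], of v] by simp
  then have "\<exists>!w. w \<in> Hom C T (Src C p) \<and> p \<cdot> w = p \<cdot> v \<and> q \<cdot> w = q \<cdot> v"
    using pb unfolding is_pullback_def by (auto simp del: hom_iff simp: Hom_def)
  then show ?thesis using u eq by blast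
qed

lemma regular_epi_cancel:
  assumes e: "regular_epi C e" and k: "k \<in> Arr C" "k' \<in> Arr C" "Src C k = Tgt C e" "Src C k' = Tgt C e"
    and eq: "k \<cdot> e = k' \<cdot> e"
  shows "k = k'"
proof -
  obtain u v where c: "is_coequalizer C u v e" using e unfolding regular_epi_def by blast
  have [simp]: "u \<in> Arr C" "v \<in> Arr C" "e \<in> Arr C" "Src C v = Src C u" "Tgt C v = Tgt C u" "Src C e = Tgt C u"
     and eu: "e \<cdot> u = e \<cdot> v" using c unfolding is_coequalizer_def by auto
  have T: "Tgt C k = Tgt C k'" using eq k Cmp_typing(3)[of e k] Cmp_typing(3)[of e k'] by simp
  have "(k' \<cdot> e) \<cdot> u = (k' \<cdot> e) \<cdot> v" using k by (simp add: eu)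
  moreover have "k' \<cdot> e \<in> Hom C (Tgt C u) (Tgt C k')" "Tgt C k' \<in> Obj C" using k by simp_all
  ultimately have "\<exists>!w. w \<in> Hom C (Tgt C e) (Tgt C k') \<and> w \<cdot> e = k' \<cdot> e"
    using c unfolding is_coequalizer_def by blast
  then show ?thesis using k T eq by auto
qed

text \<open>
  In terms of generalised elements a regular epimorphism is a quotient: an arrow descends along it as
  soon as it identifies all that the epimorphism identifies. The pair being coequalized is itself a
  pair of identified elements.
\<close>

lemma regular_epi_lift:
  assumes e: "regular_epi C e" and h: "h \<in> Hom C (Src C e) Y"
    and eq: "\<And>W s t. s \<in> Hom C W (Src C e) \<Longrightarrow> t \<in> Hom C W (Src C e) \<Longrightarrow> e \<cdot> s = e \<cdot> t \<Longrightarrow> h \<cdot> s = h \<cdot> t"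
  obtains k where "k \<in> Hom C (Tgt C e) Y" "k \<cdot> e = h"
proof -
  obtain u v where c: "is_coequalizer C u v e" using e unfolding regular_epi_def by blast
  have "u \<in> Hom C (Src C u) (Src C e)" "v \<in> Hom C (Src C u) (Src C e)" "e \<cdot> u = e \<cdot> v" "Tgt C u = Src C e"
    using c unfolding is_coequalizer_def by auto
  from eq[OF this(1-3)] this(4) show ?thesis
    using c h HomD(5)[OF h] that unfolding is_coequalizer_def by metis
qed

lemma is_pullbackI:
  assumes "g \<in> Hom C A D" "f \<in> Hom C B D" "p \<in> Hom C P A" "q \<in> Hom C P B" "g \<cdot> p = f \<cdot> q"
    and ex: "\<And>T s t. \<lbrakk>s \<in> Hom C T A; t \<in> Hom C T B; g \<cdot> s = f \<cdot> t\<rbrakk> \<Longrightarrow>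
      \<exists>u \<in> Hom C T P. p \<cdot> u = s \<and> q \<cdot> u = t"
    and uq: "\<And>T u v. \<lbrakk>u \<in> Hom C T P; v \<in> Hom C T P; p \<cdot> u = p \<cdot> v; q \<cdot> u = q \<cdot> v\<rbrakk> \<Longrightarrow> u = v"
  shows "is_pullback C g f p q"
proof -
  have S: "Src C g = A" "Src C f = B" "Src C p = P" using assms by simp_all
  have *: "\<exists>!u. u \<in> Hom C T P \<and> p \<cdot> u = s \<and> q \<cdot> u = t"
    if st: "s \<in> Hom C T A" "t \<in> Hom C T B" "g \<cdot> s = f \<cdot> t" for T s t
  proof -
    obtain u where u: "u \<in> Hom C T P" "p \<cdot> u = s" "q \<cdot> u = t" using ex[OF st] by blast
    show ?thesis by (intro ex1I[of _ u] conjI u) (metis uq u)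
  qed
  show ?thesis
    unfolding is_pullback_def S by (intro conjI ballI impI *) (use assms(1-5) in simp_all)
qed

lemma coequalizerD:
  assumes "is_coequalizer C u v q"
  shows "u \<in> Arr C" "v \<in> Arr C" "q \<in> Arr C" "Src C v = Src C u" "Tgt C v = Tgt C u" "Src C q = Tgt C u"
    "q \<cdot> u = q \<cdot> v"
  using assms unfolding is_coequalizer_def by auto

lemma coequalizer_lift:
  assumes "is_coequalizer C u v q" "h \<in> Hom C (Tgt C u) T" "h \<cdot> u = h \<cdot> v"
  obtains k where "k \<in> Hom C (Tgt C q) T" "k \<cdot> q = h"
  using assms HomD(5)[OF assms(2)] unfolding is_coequalizer_def by blast

lemma regular_epi_iso_Cmp:
  assumes e: "regular_epi C e" and s: "s \<in> Hom C (Tgt C e) I" "t \<in> Hom C I (Tgt C e)"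
    and inv: "s \<cdot> t = Idn C I" "t \<cdot> s = Idn C (Tgt C e)"
  shows "regular_epi C (s \<cdot> e)"
proof -
  obtain u v where c: "is_coequalizer C u v e" using e unfolding regular_epi_def by blast
  note [simp] = coequalizerD[OF c] HomD[OF s(1)] HomD[OF s(2)]
  have se: "Tgt C (s \<cdot> e) = I" by simp
  have *: "\<exists>!k. k \<in> Hom C I T \<and> k \<cdot> (s \<cdot> e) = h"
    if h: "h \<in> Hom C (Tgt C u) T" "h \<cdot> u = h \<cdot> v" for T h
  proof -
    note [simp] = HomD[OF h(1)]
    obtain k where k: "k \<in> Hom C (Tgt C e) T" "k \<cdot> e = h" by (rule coequalizer_lift[OF c h])
    note [simp] = HomD[OF k(1)]
    show ?thesis
    proof (rule ex1I[of _ "k \<cdot> t"], intro conjI)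
      show "(k \<cdot> t) \<cdot> (s \<cdot> e) = h"
        using Cmp_reduce[OF inv(2), of e] by (simp add: k)
    next
      fix l assume l: "l \<in> Hom C I T \<and> l \<cdot> (s \<cdot> e) = h"
      then have "(l \<cdot> s) \<cdot> e = k \<cdot> e" by (simp add: k)
      then have "l \<cdot> s = k" by (rule regular_epi_cancel[OF e, rotated -1]) (use l in simp_all)
      then show "l = k \<cdot> t" using Cmp_assoc'[of t s l] l by (simp add: inv)
    qed simp
  qed
  have "is_coequalizer C u v (s \<cdot> e)"
    unfolding is_coequalizer_def se
    by (intro conjI ballI impI *) simp_all
  then show ?thesis unfolding regular_epi_def by blast
qed

end

section \<open>Products and zero arrows in a unital category\<close>

locale unital_category = category C for C :: "('o, 'm) cat" (structure) +
  assumes unital: "unital C"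
begin

lemma fin_complete: "finitely_complete C"
  using unital by (simp add: unital_def)

definition zero_ob :: 'o where
  "zero_ob = (SOME Z. zero_object C Z)"

definition zero_map :: "'o \<Rightarrow> 'o \<Rightarrow> 'm" where
  "zero_map A B = (THE t. t \<in> Hom C zero_ob B) \<cdot> (THE s. s \<in> Hom C A zero_ob)"

lemma zero_object_zero_ob: "zero_object C zero_ob"
  unfolding zero_ob_def using unital by (auto simp: unital_def pointed_def intro: someI)

lemma zero_ob_Obj [simp]: "zero_ob \<in> Obj C"
  using zero_object_zero_ob by (simp add: zero_object_def terminal_def)

lemma ex1_to_zero: "A \<in> Obj C \<Longrightarrow> \<exists>!f. f \<in> Hom C A zero_ob"
  using zero_object_zero_ob unfolding zero_object_def terminal_def by blast

lemma ex1_from_zero: "A \<in> Obj C \<Longrightarrow> \<exists>!f. f \<in> Hom C zero_ob A"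
proof -
  have "Hom (op_cat C) A zero_ob = Hom C zero_ob A" "Obj (op_cat C) = Obj C"
    by (auto simp: op_cat_def Hom_def)
  then show "A \<in> Obj C \<Longrightarrow> \<exists>!f. f \<in> Hom C zero_ob A"
    using zero_object_zero_ob unfolding zero_object_def terminal_def by blast
qed

lemma zero_map_through_zero:
  assumes "s \<in> Hom C A zero_ob" "t \<in> Hom C zero_ob B"
  shows "t \<cdot> s = zero_map A B"
proof -
  have "(THE t. t \<in> Hom C zero_ob B) = t" "(THE s. s \<in> Hom C A zero_ob) = s"
    using assms ex1_from_zero[OF HomD(5)[OF assms(2)]] ex1_to_zero[OF HomD(4)[OF assms(1)]]
    by (auto intro!: the1_equality simp del: hom_iff)
  then show ?thesis by (simp add: zero_map_def)
qed

lemma zero_map_factor: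
  assumes "A \<in> Obj C" "B \<in> Obj C"
  obtains s t where "s \<in> Hom C A zero_ob" "t \<in> Hom C zero_ob B" "zero_map A B = t \<cdot> s"
  using ex1_to_zero[OF assms(1)] ex1_from_zero[OF assms(2)] zero_map_through_zero by metis

lemma zero_map_typing [simp]:
  assumes "A \<in> Obj C" "B \<in> Obj C"
  shows "zero_map A B \<in> Arr C" "Src C (zero_map A B) = A" "Tgt C (zero_map A B) = B"
  using zero_map_factor[OF assms] by (metis Cmp_typing hom_iff)+

lemma zero_map_Cmp [simp]:
  assumes "f \<in> Arr C" "Tgt C f = B" "D \<in> Obj C"
  shows "zero_map B D \<cdot> f = zero_map (Src C f) D"
proof -
  have "B \<in> Obj C" using assms by auto
  from zero_map_factor[OF this assms(3)] obtain s t
    where st: "s \<in> Hom C B zero_ob" "t \<in> Hom C zero_ob D" "zero_map B D = t \<cdot> s" .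
  then have "zero_map B D \<cdot> f = t \<cdot> (s \<cdot> f)" using assms by simp
  also have "\<dots> = zero_map (Src C f) D" using st assms by (intro zero_map_through_zero) simp_all
  finally show ?thesis .
qed

lemma Cmp_zero_map [simp]:
  assumes "f \<in> Arr C" "Src C f = B" "A \<in> Obj C"
  shows "f \<cdot> zero_map A B = zero_map A (Tgt C f)"
proof -
  have "B \<in> Obj C" using assms by auto
  from zero_map_factor[OF assms(3) this] obtain s t
    where st: "s \<in> Hom C A zero_ob" "t \<in> Hom C zero_ob B" "zero_map A B = t \<cdot> s" .
  then have "f \<cdot> zero_map A B = (f \<cdot> t) \<cdot> s" using assms by simp
  also have "\<dots> = zero_map A (Tgt C f)" using st assms by (intro zero_map_through_zero) simp_all
  finally show ?thesis .
qed

lemma zero_arrow_zero_map: "A \<in> Obj C \<Longrightarrow> B \<in> Obj C \<Longrightarrow> zero_arrow C A B (zero_map A B)"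
  unfolding zero_arrow_def using zero_object_zero_ob zero_map_factor by metis

lemma product_exists:
  assumes "A \<in> Obj C" "B \<in> Obj C"
  shows "\<exists>pq. is_product C A B (Src C (fst pq)) (fst pq) (snd pq)"
proof -
  obtain p q where pb: "is_pullback C (zero_map A zero_ob) (zero_map B zero_ob) p q"
    using pullback_exists[OF fin_complete, of "zero_map A zero_ob" A zero_ob "zero_map B zero_ob" B] assms by auto
  note [simp] = pullbackD[OF pb]
  have *: "\<exists>!h. h \<in> Hom C X (Src C p) \<and> p \<cdot> h = f \<and> q \<cdot> h = g"
    if "f \<in> Hom C X A" "g \<in> Hom C X B" for X f g
  proof -
    note [simp] = HomD[OF that(1)] HomD[OF that(2)]
    obtain h where "h \<in> Hom C X (Src C p)" "p \<cdot> h = f" "q \<cdot> h = g"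
      by (rule pullback_lift[OF pb, of f X g]) (use assms in auto)
    then show ?thesis
      by (intro ex1I[of _ h] conjI) (auto intro: pullback_ext[OF pb, of _ X])
  qed
  have "is_product C A B (Src C p) p q"
    unfolding is_product_def by (intro conjI ballI *) (simp_all add: assms)
  then show ?thesis by (intro exI[of _ "(p, q)"]) simp
qed

definition projs :: "'o \<Rightarrow> 'o \<Rightarrow> 'm \<times> 'm" where
  "projs A B = (SOME pq. is_product C A B (Src C (fst pq)) (fst pq) (snd pq))"

definition pr1 :: "'o \<Rightarrow> 'o \<Rightarrow> 'm" where "pr1 A B = fst (projs A B)"
definition pr2 :: "'o \<Rightarrow> 'o \<Rightarrow> 'm" where "pr2 A B = snd (projs A B)"
definition prod_ob :: "'o \<Rightarrow> 'o \<Rightarrow> 'o" where "prod_ob A B = Src C (pr1 A B)"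
definition pair :: "'m \<Rightarrow> 'm \<Rightarrow> 'm" where
  "pair f g = tuple C (pr1 (Tgt C f) (Tgt C g)) (pr2 (Tgt C f) (Tgt C g)) f g"

lemma is_product_prod_ob:
  assumes "A \<in> Obj C" "B \<in> Obj C"
  shows "is_product C A B (prod_ob A B) (pr1 A B) (pr2 A B)"
  unfolding prod_ob_def pr1_def pr2_def projs_def by (rule someI_ex[OF product_exists[OF assms]])

lemma prod_ob_typing [simp]:
  assumes "A \<in> Obj C" "B \<in> Obj C"
  shows "prod_ob A B \<in> Obj C" "pr1 A B \<in> Arr C" "Src C (pr1 A B) = prod_ob A B" "Tgt C (pr1 A B) = A"
    "pr2 A B \<in> Arr C" "Src C (pr2 A B) = prod_ob A B" "Tgt C (pr2 A B) = B"
  using is_product_prod_ob[OF assms] unfolding is_product_def by auto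

lemma tuple_eq:
  assumes P: "is_product C A B P p1 p2" and f: "f \<in> Hom C X A" "g \<in> Hom C X B"
  shows "tuple C p1 p2 f g \<in> Hom C X P" "p1 \<cdot> tuple C p1 p2 f g = f" "p2 \<cdot> tuple C p1 p2 f g = g"
proof -
  note [simp] = HomD[OF f(1)] HomD[OF f(2)]
  have "\<exists>!h. h \<in> Hom C X P \<and> p1 \<cdot> h = f \<and> p2 \<cdot> h = g"
    using P f unfolding is_product_def by auto
  then have "\<exists>!h. h \<in> Hom C (Src C f) (Src C p1) \<and> p1 \<cdot> h = f \<and> p2 \<cdot> h = g"
    using P unfolding is_product_def by simp
  from theI'[OF this]
  show "tuple C p1 p2 f g \<in> Hom C X P" "p1 \<cdot> tuple C p1 p2 f g = f" "p2 \<cdot> tuple C p1 p2 f g = g"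
    using P unfolding is_product_def tuple_def by simp_all
qed

lemma product_ext:
  assumes P: "is_product C A B P p1 p2" and f: "f \<in> Hom C X P" "g \<in> Hom C X P"
    and eq: "p1 \<cdot> f = p1 \<cdot> g" "p2 \<cdot> f = p2 \<cdot> g"
  shows "f = g"
proof -
  note [simp] = HomD[OF f(1)] HomD[OF f(2)]
  have "p1 \<in> Hom C P A" "p2 \<in> Hom C P B" using P unfolding is_product_def by blast+
  then have "p1 \<cdot> g \<in> Hom C X A" "p2 \<cdot> g \<in> Hom C X B" using f by simp_all
  then have "\<exists>!h. h \<in> Hom C X P \<and> p1 \<cdot> h = p1 \<cdot> g \<and> p2 \<cdot> h = p2 \<cdot> g"
    using P HomD(4)[OF f(1)] unfolding is_product_def by blast
  then show ?thesis using f eq by blast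
qed

lemma pair_typing [simp]:
  assumes "f \<in> Arr C" "g \<in> Arr C" "Src C g = Src C f"
  shows "pair f g \<in> Arr C" "Src C (pair f g) = Src C f" "Tgt C (pair f g) = prod_ob (Tgt C f) (Tgt C g)"
  using tuple_eq(1)[OF is_product_prod_ob, of "Tgt C f" "Tgt C g" f "Src C f" g] assms
  by (simp_all add: pair_def)

lemma pr_pair [simp]:
  assumes "f \<in> Arr C" "g \<in> Arr C" "Src C g = Src C f" "Tgt C f = A" "Tgt C g = B"
  shows "pr1 A B \<cdot> pair f g = f" "pr2 A B \<cdot> pair f g = g"
  using tuple_eq(2,3)[OF is_product_prod_ob, of A B f "Src C f" g] assms
  by (auto simp: pair_def)

lemma pair_ext:
  assumes "h \<in> Hom C W (prod_ob A B)" "k \<in> Hom C W (prod_ob A B)" "pr1 A B \<cdot> h = pr1 A B \<cdot> k"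
    "pr2 A B \<cdot> h = pr2 A B \<cdot> k" "A \<in> Obj C" "B \<in> Obj C"
  shows "h = k"
  using product_ext[OF is_product_prod_ob assms(1-4)] assms by simp

lemma pair_Cmp [simp]:
  assumes "f \<in> Arr C" "g \<in> Arr C" "Src C g = Src C f" "h \<in> Arr C" "Tgt C h = Src C f"
  shows "pair f g \<cdot> h = pair (f \<cdot> h) (g \<cdot> h)"
proof (rule pair_ext[of _ "Src C h" "Tgt C f" "Tgt C g"])
  show "pr1 (Tgt C f) (Tgt C g) \<cdot> (pair f g \<cdot> h) = pr1 (Tgt C f) (Tgt C g) \<cdot> pair (f \<cdot> h) (g \<cdot> h)"
    using assms Cmp_reduce[OF pr_pair(1), of f g "Tgt C f" "Tgt C g" h] by simp
  show "pr2 (Tgt C f) (Tgt C g) \<cdot> (pair f g \<cdot> h) = pr2 (Tgt C f) (Tgt C g) \<cdot> pair (f \<cdot> h) (g \<cdot> h)"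
    using assms Cmp_reduce[OF pr_pair(2), of f g "Tgt C f" "Tgt C g" h] by simp
qed (use assms in simp_all)

lemma pair_eta [simp]:
  assumes "h \<in> Arr C" "Tgt C h = prod_ob A B" "A \<in> Obj C" "B \<in> Obj C"
  shows "pair (pr1 A B \<cdot> h) (pr2 A B \<cdot> h) = h"
  by (rule pair_ext[of _ "Src C h" A B]) (use assms in simp_all)

lemma pair_pr [simp]:
  assumes "A \<in> Obj C" "B \<in> Obj C"
  shows "pair (pr1 A B) (pr2 A B) = Idn C (prod_ob A B)"
  by (rule pair_ext[of _ "prod_ob A B" A B]) (use assms in simp_all)

lemma pair_zero_map [simp]:
  assumes "W \<in> Obj C" "A \<in> Obj C" "B \<in> Obj C"
  shows "pair (zero_map W A) (zero_map W B) = zero_map W (prod_ob A B)"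
  by (rule pair_ext[of _ W A B]) (use assms in simp_all)

lemma pair_eqD:
  assumes "pair f g = pair f' g'" "f \<in> Hom C W A" "g \<in> Hom C W B" "f' \<in> Hom C W A" "g' \<in> Hom C W B"
  shows "f = f'" "g = g'"
proof -
  note [simp] = HomD[OF assms(2)] HomD[OF assms(3)] HomD[OF assms(4)] HomD[OF assms(5)]
  have "pr1 A B \<cdot> pair f g = pr1 A B \<cdot> pair f' g'" "pr2 A B \<cdot> pair f g = pr2 A B \<cdot> pair f' g'"
    by (simp_all only: assms(1))
  then show "f = f'" "g = g'" by simp_all
qed

abbreviation inl :: "'o \<Rightarrow> 'o \<Rightarrow> 'm" where "inl A B \<equiv> pair (Idn C A) (zero_map A B)"
abbreviation inr :: "'o \<Rightarrow> 'o \<Rightarrow> 'm" where "inr A B \<equiv> pair (zero_map B A) (Idn C B)"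

lemma inl_inr_jointly_strongly_epi:
  assumes "A \<in> Obj C" "B \<in> Obj C"
  shows "jointly_strongly_epi C (inl A B) (inr A B)"
proof -
  have "jointly_strongly_epi C (tuple C (pr1 A B) (pr2 A B) (Idn C A) (zero_map A B))
      (tuple C (pr1 A B) (pr2 A B) (zero_map B A) (Idn C B))"
    using unital is_product_prod_ob[OF assms] zero_arrow_zero_map[OF assms] zero_arrow_zero_map[OF assms(2,1)]
    unfolding unital_def by blast
  then show ?thesis using assms by (simp add: pair_def)
qed

lemma unital_ext:
  assumes f: "f \<in> Hom C (prod_ob A B) X" "g \<in> Hom C (prod_ob A B) X" and obj: "A \<in> Obj C" "B \<in> Obj C"
    and eq: "f \<cdot> inl A B = g \<cdot> inl A B" "f \<cdot> inr A B = g \<cdot> inr A B"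
  shows "f = g"
proof -
  have "\<forall>X \<in> Obj C. \<forall>f \<in> Hom C (Tgt C (inl A B)) X. \<forall>g \<in> Hom C (Tgt C (inl A B)) X.
      f \<cdot> inl A B = g \<cdot> inl A B \<longrightarrow> f \<cdot> inr A B = g \<cdot> inr A B \<longrightarrow> f = g"
    using inl_inr_jointly_strongly_epi[OF obj] unfolding jointly_strongly_epi_def by blast
  moreover have "Tgt C (inl A B) = prod_ob A B" using obj by simp
  ultimately show ?thesis using f eq HomD(5)[OF f(1)] by metis
qed

lemma unital_fill:
  assumes m: "mono_arrow C m" "m \<in> Hom C M X" and h: "h \<in> Hom C (prod_ob A B) X"
    and obj: "A \<in> Obj C" "B \<in> Obj C"
    and f: "f \<in> Hom C A M" "g \<in> Hom C B M" "h \<cdot> inl A B = m \<cdot> f" "h \<cdot> inr A B = m \<cdot> g"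
  obtains d where "d \<in> Hom C (prod_ob A B) M" "m \<cdot> d = h"
proof -
  have "Tgt C (inl A B) = prod_ob A B" "Src C (inl A B) = A" "Src C (inr A B) = B" "Tgt C m = X" "Src C m = M"
    using obj m by simp_all
  moreover have "\<forall>m h. mono_arrow C m \<longrightarrow> h \<in> Hom C (Tgt C (inl A B)) (Tgt C m) \<longrightarrow>
        (\<forall>f \<in> Hom C (Src C (inl A B)) (Src C m). \<forall>g \<in> Hom C (Src C (inr A B)) (Src C m).
           h \<cdot> inl A B = m \<cdot> f \<longrightarrow> h \<cdot> inr A B = m \<cdot> g \<longrightarrow>
           (\<exists>d \<in> Hom C (Tgt C (inl A B)) (Src C m). m \<cdot> d = h \<and> d \<cdot> inl A B = f \<and> d \<cdot> inr A B = g))"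
    using inl_inr_jointly_strongly_epi[OF obj] unfolding jointly_strongly_epi_def by blast
  ultimately show ?thesis using m(1) h f that by metis
qed

end

section \<open>Commutative and abelian objects\<close>

context unital_category
begin

text \<open>
  A multiplication with two-sided unit on an object of a unital category is already a commutative
  monoid structure; the remaining laws are derived below.
\<close>

definition unital_magma :: "'o \<Rightarrow> 'm \<Rightarrow> bool" where
  "unital_magma A m \<longleftrightarrow> A \<in> Obj C \<and> m \<in> Hom C (prod_ob A A) A \<and>
     m \<cdot> inl A A = Idn C A \<and> m \<cdot> inr A A = Idn C A"

definition commutative :: "'o \<Rightarrow> bool" where
  "commutative A \<longleftrightarrow> (\<exists>m. unital_magma A m)"

text \<open>
  The choice is immaterial, since there is at most one unital multiplication on A.
\<close>

definition mult :: "'o \<Rightarrow> 'm" where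
  "mult A = (SOME m. unital_magma A m)"

definition add :: "'m \<Rightarrow> 'm \<Rightarrow> 'm"  (infixl "\<oplus>" 65) where
  "x \<oplus> y = mult (Tgt C x) \<cdot> pair x y"

lemma unital_magma_mult: "commutative A \<Longrightarrow> unital_magma A (mult A)"
  unfolding commutative_def mult_def by (rule someI_ex)

lemma commutative_Obj [simp]: "commutative A \<Longrightarrow> A \<in> Obj C"
  by (auto simp: commutative_def unital_magma_def)

lemma mult_typing [simp]:
  assumes "commutative A"
  shows "mult A \<in> Arr C" "Src C (mult A) = prod_ob A A" "Tgt C (mult A) = A"
    "mult A \<cdot> pair (Idn C A) (zero_map A A) = Idn C A" "mult A \<cdot> pair (zero_map A A) (Idn C A) = Idn C A"
  using unital_magma_mult[OF assms] by (auto simp: unital_magma_def)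

lemma add_typing [simp]:
  assumes "x \<in> Arr C" "y \<in> Arr C" "Src C y = Src C x" "Tgt C y = Tgt C x" "commutative (Tgt C x)"
  shows "x \<oplus> y \<in> Arr C" "Src C (x \<oplus> y) = Src C x" "Tgt C (x \<oplus> y) = Tgt C x"
  using assms by (simp_all add: add_def)

lemma add_Cmp [simp]:
  assumes "x \<in> Arr C" "y \<in> Arr C" "Src C y = Src C x" "Tgt C y = Tgt C x" "commutative (Tgt C x)"
    "h \<in> Arr C" "Tgt C h = Src C x"
  shows "(x \<oplus> y) \<cdot> h = x \<cdot> h \<oplus> y \<cdot> h"
  using assms by (simp add: add_def)

lemma add_zero_map [simp]:
  assumes "x \<in> Arr C" "Src C x = W" "Tgt C x = A" "commutative A"
  shows "x \<oplus> zero_map W A = x" "zero_map W A \<oplus> x = x"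
proof -
  have W: "W \<in> Obj C" using assms by auto
  have "mult A \<cdot> (pair (Idn C A) (zero_map A A) \<cdot> x) = Idn C A \<cdot> x"
    by (rule Cmp_reduce) (use assms W in simp_all)
  then show "x \<oplus> zero_map W A = x" using assms W by (simp add: add_def)
  have "mult A \<cdot> (pair (zero_map A A) (Idn C A) \<cdot> x) = Idn C A \<cdot> x"
    by (rule Cmp_reduce) (use assms W in simp_all)
  then show "zero_map W A \<oplus> x = x" using assms W by (simp add: add_def)
qed

text \<open>
  The sum on the right has the same restrictions to A and B as f.
\<close>

lemma split_sum:
  assumes f: "f \<in> Hom C (prod_ob A B) X" and obj: "A \<in> Obj C" "B \<in> Obj C" and X: "commutative X"
  shows "f = (f \<cdot> inl A B) \<cdot> pr1 A B \<oplus> (f \<cdot> inr A B) \<cdot> pr2 A B"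
  by (rule unital_ext[of _ A B X]) (use assms in simp_all)

lemma Cmp_pair_eq_add:
  assumes f: "f \<in> Hom C (prod_ob A B) X" and X: "commutative X" and xy: "x \<in> Hom C W A" "y \<in> Hom C W B"
  shows "f \<cdot> pair x y = (f \<cdot> inl A B) \<cdot> x \<oplus> (f \<cdot> inr A B) \<cdot> y"
proof -
  note [simp] = HomD[OF f] HomD[OF xy(1)] HomD[OF xy(2)]
  have "f \<cdot> pair x y = ((f \<cdot> inl A B) \<cdot> pr1 A B \<oplus> (f \<cdot> inr A B) \<cdot> pr2 A B) \<cdot> pair x y"
    using split_sum[OF f _ _ X] by simp
  also have "\<dots> = (f \<cdot> inl A B) \<cdot> x \<oplus> (f \<cdot> inr A B) \<cdot> y"
    using X by (simp del: pair_Cmp)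
  finally show ?thesis .
qed

text \<open>
  Every arrow between commutative objects is a homomorphism: as arrows out of the product, both sides
  restrict to f on either factor.
\<close>

lemma Cmp_add [simp]:
  assumes "x \<in> Arr C" "y \<in> Arr C" "Src C y = Src C x" "Tgt C y = Tgt C x" "commutative (Tgt C x)"
    "f \<in> Arr C" "Src C f = Tgt C x" "commutative (Tgt C f)"
  shows "f \<cdot> (x \<oplus> y) = f \<cdot> x \<oplus> f \<cdot> y"
proof -
  let ?A = "Tgt C x"
  have "(f \<cdot> mult ?A) \<cdot> pair x y =
      ((f \<cdot> mult ?A) \<cdot> inl ?A ?A) \<cdot> x \<oplus> ((f \<cdot> mult ?A) \<cdot> inr ?A ?A) \<cdot> y"
    by (rule Cmp_pair_eq_add[where X = "Tgt C f" and W = "Src C x"]) (use assms in simp_all)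
  then show ?thesis using assms by (simp add: add_def)
qed

lemma add_commute:
  assumes "x \<in> Hom C W A" "y \<in> Hom C W A" "commutative A"
  shows "x \<oplus> y = y \<oplus> x"
proof -
  note [simp] = HomD[OF assms(1)] HomD[OF assms(2)] assms(3)
  have "(pr2 A A \<oplus> pr1 A A) \<cdot> pair x y =
      ((pr2 A A \<oplus> pr1 A A) \<cdot> inl A A) \<cdot> x \<oplus> ((pr2 A A \<oplus> pr1 A A) \<cdot> inr A A) \<cdot> y"
    by (rule Cmp_pair_eq_add[where X = A and W = W]) simp_all
  then show ?thesis by simp
qed

text \<open>
  Both sides are arrows out of a product, with the same restrictions to the factors.
\<close>

lemma add_assoc:
  assumes "x \<in> Hom C W A" "y \<in> Hom C W A" "z \<in> Hom C W A" "commutative A"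
  shows "(x \<oplus> y) \<oplus> z = x \<oplus> (y \<oplus> z)"
proof -
  note [simp] = HomD[OF assms(1)] HomD[OF assms(2)] HomD[OF assms(3)] assms(4)
  let ?f = "pr1 A A \<cdot> pr1 (prod_ob A A) A \<oplus> (pr2 A A \<cdot> pr1 (prod_ob A A) A \<oplus> pr2 (prod_ob A A) A)"
  have "?f \<cdot> pair (pair x y) z =
      (?f \<cdot> inl (prod_ob A A) A) \<cdot> pair x y \<oplus> (?f \<cdot> inr (prod_ob A A) A) \<cdot> z"
    by (rule Cmp_pair_eq_add[where X = A and W = W]) simp_all
  then show ?thesis by simp
qed

lemma unital_magma_unique:
  assumes "unital_magma A m"
  shows "mult A = m"
proof -
  have A: "commutative A" using assms by (auto simp: commutative_def)
  show ?thesis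
  proof (rule unital_ext[of _ A A A])
    show "mult A \<cdot> inl A A = m \<cdot> inl A A" "mult A \<cdot> inr A A = m \<cdot> inr A A"
      using assms A by (simp_all add: unital_magma_def)
  qed (use assms A in \<open>simp_all add: unital_magma_def\<close>)
qed

definition is_inversion :: "'o \<Rightarrow> 'm \<Rightarrow> bool" where
  "is_inversion A i \<longleftrightarrow> i \<in> Hom C A A \<and> Idn C A \<oplus> i = zero_map A A"

text \<open>
  Refers to the chosen products; by \<open>abelian_object_iff\<close> it agrees with the existence of an abelian
  group structure over arbitrary ones.
\<close>

definition abelian :: "'o \<Rightarrow> bool" where
  "abelian A \<longleftrightarrow> commutative A \<and> (\<exists>i. is_inversion A i)"

definition neg :: "'m \<Rightarrow> 'm" where
  "neg x = (SOME i. is_inversion (Tgt C x) i) \<cdot> x"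

lemma abelian_commutative [simp]: "abelian A \<Longrightarrow> commutative A"
  by (simp add: abelian_def)

lemma add_cancel:
  assumes x: "x \<in> Hom C W A" "y \<in> Hom C W A" "z \<in> Hom C W A" "x' \<in> Hom C W A" and A: "commutative A"
    and inv: "x' \<oplus> x = zero_map W A" and eq: "x \<oplus> y = x \<oplus> z"
  shows "y = z"
proof -
  note [simp] = HomD[OF x(1)] HomD[OF x(2)] HomD[OF x(3)] HomD[OF x(4)] A
  have "(x' \<oplus> x) \<oplus> y = (x' \<oplus> x) \<oplus> z"
    using add_assoc[OF x(4,1,2) A] add_assoc[OF x(4,1,3) A] eq by simp
  then show ?thesis by (simp add: inv)
qed

lemma is_inversion_neg:
  assumes "abelian (Tgt C x)"
  shows "is_inversion (Tgt C x) (SOME i. is_inversion (Tgt C x) i)"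
  using assms unfolding abelian_def by (blast intro: someI_ex)

lemma neg_typing [simp]:
  assumes "x \<in> Arr C" "abelian (Tgt C x)"
  shows "neg x \<in> Arr C" "Src C (neg x) = Src C x" "Tgt C (neg x) = Tgt C x"
  using is_inversion_neg[OF assms(2)] assms(1) by (simp_all add: neg_def is_inversion_def)

lemma neg_Cmp [simp]:
  assumes "x \<in> Arr C" "abelian (Tgt C x)" "h \<in> Arr C" "Tgt C h = Src C x"
  shows "neg x \<cdot> h = neg (x \<cdot> h)"
  using is_inversion_neg[OF assms(2)] assms by (simp add: neg_def is_inversion_def)

lemma add_neg [simp]:
  assumes "x \<in> Arr C" "abelian (Tgt C x)"
  shows "x \<oplus> neg x = zero_map (Src C x) (Tgt C x)" "neg x \<oplus> x = zero_map (Src C x) (Tgt C x)"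
proof -
  let ?i = "SOME i. is_inversion (Tgt C x) i"
  note i = is_inversion_neg[OF assms(2)]
  have [simp]: "?i \<in> Arr C" "Src C ?i = Tgt C x" "Tgt C ?i = Tgt C x"
    using i by (auto simp: is_inversion_def)
  have "(Idn C (Tgt C x) \<oplus> ?i) \<cdot> x = zero_map (Tgt C x) (Tgt C x) \<cdot> x"
    using i by (simp add: is_inversion_def)
  moreover have "(Idn C (Tgt C x) \<oplus> ?i) \<cdot> x = x \<oplus> neg x"
    using assms by (subst add_Cmp) (simp_all add: neg_def)
  ultimately show "x \<oplus> neg x = zero_map (Src C x) (Tgt C x)" using assms by simp
  then show "neg x \<oplus> x = zero_map (Src C x) (Tgt C x)"
    using add_commute[of x "Src C x" "Tgt C x" "neg x"] assms by simp
qed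

lemma abelian_cancel:
  assumes "x \<in> Hom C W A" "y \<in> Hom C W A" "z \<in> Hom C W A" "abelian A" "x \<oplus> y = x \<oplus> z"
  shows "y = z"
  by (rule add_cancel[OF assms(1-3), of "neg x"]) (use assms in simp_all)

lemma add_diff:
  assumes "x \<in> Hom C W A" "y \<in> Hom C W A" "abelian A"
  shows "x \<oplus> (neg x \<oplus> y) = y"
proof -
  note [simp] = HomD[OF assms(1)] HomD[OF assms(2)] assms(3)
  show ?thesis using add_assoc[of x W A "neg x" y] by simp
qed

lemma eq_if_diff_zero_map:
  assumes "x \<in> Hom C W A" "y \<in> Hom C W A" "abelian A" "neg x \<oplus> y = zero_map W A"
  shows "x = y"
  using add_diff[OF assms(1-3)] assms by simp

lemma Cmp_neg [simp]:
  assumes "x \<in> Arr C" "abelian (Tgt C x)" "f \<in> Arr C" "Src C f = Tgt C x" "abelian (Tgt C f)"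
  shows "f \<cdot> neg x = neg (f \<cdot> x)"
proof (rule abelian_cancel[of "f \<cdot> x" "Src C x" "Tgt C f"])
  have "f \<cdot> (x \<oplus> neg x) = f \<cdot> x \<oplus> f \<cdot> neg x" by (rule Cmp_add) (use assms in simp_all)
  then show "f \<cdot> x \<oplus> f \<cdot> neg x = f \<cdot> x \<oplus> neg (f \<cdot> x)" using assms by simp
qed (use assms in simp_all)

lemma neg_zero_map [simp]:
  assumes "abelian A" "W \<in> Obj C"
  shows "neg (zero_map W A) = zero_map W A"
  using add_zero_map(2)[of "neg (zero_map W A)" W A] add_neg(1)[of "zero_map W A"] assms by simp

lemma tuple_Cmp:
  assumes P: "is_product C A B P p1 p2" and f: "f \<in> Hom C X A" "g \<in> Hom C X B" "h \<in> Hom C W X"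
  shows "tuple C p1 p2 f g \<cdot> h = tuple C p1 p2 (f \<cdot> h) (g \<cdot> h)"
proof (rule product_ext[OF P])
  note [simp] = HomD[OF f(1)] HomD[OF f(2)] HomD[OF f(3)]
  have [simp]: "p1 \<in> Arr C" "p2 \<in> Arr C" "Src C p1 = P" "Src C p2 = P"
    using P by (auto simp: is_product_def)
  have fh: "f \<cdot> h \<in> Hom C W A" "g \<cdot> h \<in> Hom C W B" by simp_all
  note t = tuple_eq[OF P f(1,2)] and t' = tuple_eq[OF P fh]
  note [simp] = HomD[OF t(1)]
  show "tuple C p1 p2 f g \<cdot> h \<in> Hom C W P" "tuple C p1 p2 (f \<cdot> h) (g \<cdot> h) \<in> Hom C W P"
    using t' by simp_all
  show "p1 \<cdot> tuple C p1 p2 f g \<cdot> h = p1 \<cdot> tuple C p1 p2 (f \<cdot> h) (g \<cdot> h)"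
    using Cmp_reduce[OF t(2), of h] t' by simp
  show "p2 \<cdot> tuple C p1 p2 f g \<cdot> h = p2 \<cdot> tuple C p1 p2 (f \<cdot> h) (g \<cdot> h)"
    using Cmp_reduce[OF t(3), of h] t' by simp
qed

text \<open>
  The unit of a group structure may be given on any terminal object, not just on the chosen zero
  object.
\<close>

lemma terminal_zero_map:
  assumes T: "terminal C T" and f: "b \<in> Hom C A T" "e \<in> Hom C T B"
  shows "e \<cdot> b = zero_map A B"
proof -
  note [simp] = HomD[OF f(1)] HomD[OF f(2)]
  have "\<exists>!f. f \<in> Hom C A T" using T HomD(4)[OF f(1)] unfolding terminal_def by blast
  moreover have "zero_map A T \<in> Hom C A T" by simp
  ultimately have "b = zero_map A T" using f(1) by blast
  then show ?thesis by simp
qed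

lemma abelian_object_if_abelian: "abelian A \<Longrightarrow> abelian_object C A"
proof -
  assume A [simp]: "abelian A"
  obtain b e where be: "b \<in> Hom C A zero_ob" "e \<in> Hom C zero_ob A" "zero_map A A = e \<cdot> b"
    using zero_map_factor[of A A] by auto
  let ?Q = "prod_ob A A"
  note [simp] = HomD[OF be(1)] HomD[OF be(2)]
  have tup: "tuple C (pr1 A A) (pr2 A A) x y = pair x y" if "Tgt C x = A" "Tgt C y = A" for x y
    using that by (simp add: pair_def)
  have m: "mult A \<cdot> pair x y = x \<oplus> y" if "Tgt C x = A" for x y
    using that by (simp add: add_def)
  have "abelian_group_structure C A (pr1 A A) (pr2 A A) (pr1 ?Q A) (pr2 ?Q A) b (mult A) e (neg (Idn C A))"
    using zero_object_zero_ob is_product_prod_ob[of A A] is_product_prod_ob[of ?Q A]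
      add_commute[of "pr2 A A" ?Q A "pr1 A A"] add_assoc[of "pr1 A A \<cdot> pr1 ?Q A" "prod_ob ?Q A" A "pr2 A A \<cdot> pr1 ?Q A" "pr2 ?Q A"]
    unfolding abelian_group_structure_def zero_object_def
    by (simp add: tup m be(3)[symmetric]) (simp add: add_def)
  then show ?thesis unfolding abelian_object_def by blast
qed

lemma abelian_if_abelian_object: "abelian_object C A \<Longrightarrow> abelian A"
proof -
  assume "abelian_object C A"
  then obtain p1 p2 q1 q2 b m e i where "abelian_group_structure C A p1 p2 q1 q2 b m e i"
    unfolding abelian_object_def by blast
  then have P: "is_product C A A (Src C p1) p1 p2" and T: "terminal C (Tgt C b)"
    and hom: "b \<in> Hom C A (Tgt C b)" "m \<in> Hom C (Src C p1) A" "e \<in> Hom C (Tgt C b) A" "i \<in> Hom C A A"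
    and eqs: "m \<cdot> tuple C p1 p2 (e \<cdot> b) (Idn C A) = Idn C A"
      "m \<cdot> tuple C p1 p2 (Idn C A) (e \<cdot> b) = Idn C A" "m \<cdot> tuple C p1 p2 (Idn C A) i = e \<cdot> b"
    unfolding abelian_group_structure_def by blast+
  have A [simp]: "A \<in> Obj C" using P by (simp add: is_product_def)
  have eb: "e \<cdot> b = zero_map A A" by (rule terminal_zero_map[OF T hom(1,3)])
  note [simp] = HomD[OF hom(2)] HomD[OF hom(4)]
  let ?t = "tuple C p1 p2 (pr1 A A) (pr2 A A)"
  have pr: "pr1 A A \<in> Hom C (prod_ob A A) A" "pr2 A A \<in> Hom C (prod_ob A A) A" by simp_all
  note [simp] = HomD[OF tuple_eq(1)[OF P pr]]
  have m: "(m \<cdot> ?t) \<cdot> pair x y = m \<cdot> tuple C p1 p2 x y" if "x \<in> Hom C W A" "y \<in> Hom C W A" for x y W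
  proof -
    note [simp] = HomD[OF that(1)] HomD[OF that(2)]
    have "?t \<cdot> pair x y = tuple C p1 p2 (pr1 A A \<cdot> pair x y) (pr2 A A \<cdot> pair x y)"
      by (rule tuple_Cmp[OF P pr]) simp
    then show ?thesis by simp
  qed
  have "unital_magma A (m \<cdot> ?t)"
    using m[of "Idn C A" A "zero_map A A"] m[of "zero_map A A" A "Idn C A"] eqs unfolding unital_magma_def eb by simp
  moreover from unital_magma_unique[OF this] have "is_inversion A i"
    using m[of "Idn C A" A i] eqs unfolding is_inversion_def eb add_def by simp
  ultimately show "abelian A" by (auto simp: abelian_def commutative_def)
qed

lemma abelian_object_iff: "abelian_object C A \<longleftrightarrow> abelian A"
  using abelian_object_if_abelian abelian_if_abelian_object by blast

end

section \<open>Kernels\<close>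

context unital_category
begin

lemma mono_if_trivial_kernel:
  assumes c: "c \<in> Hom C A X" and A: "abelian A" "abelian X"
    and ker: "\<And>W z. z \<in> Hom C W A \<Longrightarrow> c \<cdot> z = zero_map W X \<Longrightarrow> z = zero_map W A"
  shows "mono_arrow C c"
proof -
  note [simp] = HomD[OF c] A
  have "x = y" if xy: "x \<in> Hom C W A" "y \<in> Hom C W A" "c \<cdot> x = c \<cdot> y" for W x y
  proof (rule eq_if_diff_zero_map[OF xy(1,2) A(1)], rule ker)
    note [simp] = HomD[OF xy(1)] HomD[OF xy(2)]
    show "neg x \<oplus> y \<in> Hom C W A" by simp
    have "c \<cdot> (neg x \<oplus> y) = neg (c \<cdot> x) \<oplus> c \<cdot> y" by simp
    also have "\<dots> = zero_map W X" unfolding xy(3) by simp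
    finally show "c \<cdot> (neg x \<oplus> y) = zero_map W X" .
  qed
  then show ?thesis unfolding mono_arrow_def by simp
qed

text \<open>
  The kernel of f is the pullback of the zero arrow along f. It inherits addition and inversion from
  X because f is a homomorphism.
\<close>

lemma kernel_exists:
  assumes f: "f \<in> Hom C X T" and abelian: "abelian X" "abelian T"
  obtains K \<kappa> where "abelian K" "\<kappa> \<in> Hom C K X" "mono_arrow C \<kappa>" "f \<cdot> \<kappa> = zero_map K T"
    "\<And>W z. z \<in> Hom C W X \<Longrightarrow> f \<cdot> z = zero_map W T \<Longrightarrow> \<exists>k \<in> Hom C W K. \<kappa> \<cdot> k = z"
proof -
  note [simp] = HomD[OF f] abelian
  obtain p \<kappa> where pb: "is_pullback C (zero_map zero_ob T) f p \<kappa>"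
    using pullback_exists[OF fin_complete, of "zero_map zero_ob T" zero_ob T f X] by auto
  let ?K = "Src C \<kappa>"
  note [simp] = pullbackD(3,4)[OF pb] pullbackD(6)[OF pb, symmetric] pullbackD(7,8)[OF pb, simplified]
  have \<kappa>: "\<kappa> \<in> Hom C ?K X" by simp
  have K [simp]: "?K \<in> Obj C" by simp
  have f\<kappa>: "f \<cdot> \<kappa> = zero_map ?K T" using pullbackD(9)[OF pb] by simp
  have lift: "\<exists>k \<in> Hom C W ?K. \<kappa> \<cdot> k = z" if z: "z \<in> Hom C W X" "f \<cdot> z = zero_map W T" for W z
  proof -
    note [simp] = HomD[OF z(1)]
    obtain u where "u \<in> Hom C W (Src C p)" "\<kappa> \<cdot> u = z"
      by (rule pullback_lift[OF pb, of "zero_map W zero_ob" W z]) (use z in simp_all)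
    then show ?thesis by auto
  qed
  have mono: "mono_arrow C \<kappa>"
  proof -
    have "x = y" if xy: "x \<in> Hom C W ?K" "y \<in> Hom C W ?K" "\<kappa> \<cdot> x = \<kappa> \<cdot> y" for W x y
    proof (rule pullback_ext[OF pb, of x W y])
      note [simp] = HomD[OF xy(1)] HomD[OF xy(2)]
      have "p \<cdot> x \<in> Hom C W zero_ob" "p \<cdot> y \<in> Hom C W zero_ob" by simp_all
      then show "p \<cdot> x = p \<cdot> y" using ex1_to_zero[of W] by auto
    qed (use xy in simp_all)
    then show ?thesis unfolding mono_arrow_def by simp
  qed
  have "f \<cdot> (\<kappa> \<cdot> pr1 ?K ?K \<oplus> \<kappa> \<cdot> pr2 ?K ?K) = zero_map (prod_ob ?K ?K) T"
    using Cmp_reduce[OF f\<kappa>] by simp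
  then obtain m where m: "m \<in> Hom C (prod_ob ?K ?K) ?K" "\<kappa> \<cdot> m = \<kappa> \<cdot> pr1 ?K ?K \<oplus> \<kappa> \<cdot> pr2 ?K ?K"
    using lift[of "\<kappa> \<cdot> pr1 ?K ?K \<oplus> \<kappa> \<cdot> pr2 ?K ?K" "prod_ob ?K ?K"] by auto
  note [simp] = HomD[OF m(1)]
  have mp: "\<kappa> \<cdot> (m \<cdot> pair x y) = \<kappa> \<cdot> x \<oplus> \<kappa> \<cdot> y" if "x \<in> Hom C W ?K" "y \<in> Hom C W ?K" for W x y
    using Cmp_reduce[OF m(2), of "pair x y"] that by simp
  have 1: "m \<cdot> inl ?K ?K = Idn C ?K"
    by (rule monoD[OF mono, of _ _ ?K]) (use mp[of "Idn C ?K" ?K "zero_map ?K ?K"] in simp_all)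
  have 2: "m \<cdot> inr ?K ?K = Idn C ?K"
    by (rule monoD[OF mono, of _ _ ?K]) (use mp[of "zero_map ?K ?K" ?K "Idn C ?K"] in simp_all)
  have [simp]: "commutative ?K" unfolding commutative_def unital_magma_def using 1 2 by (intro exI[of _ m]) simp
  have "f \<cdot> neg \<kappa> = zero_map ?K T" using Cmp_reduce[OF f\<kappa>] f\<kappa> by simp
  then obtain i where i: "i \<in> Hom C ?K ?K" "\<kappa> \<cdot> i = neg \<kappa>"
    using lift[of "neg \<kappa>" ?K] by auto
  note [simp] = HomD[OF i(1)]
  have "Idn C ?K \<oplus> i = zero_map ?K ?K"
    by (rule monoD[OF mono, of _ _ ?K]) (simp_all add: i)
  then have "abelian ?K" unfolding abelian_def is_inversion_def using i(1) by (intro conjI exI[of _ i]) simp_all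
  then show ?thesis using that[OF _ \<kappa> mono f\<kappa> lift] by blast
qed

lemma kernel_difference:
  assumes f: "f \<in> Hom C X T" "abelian X" "abelian T" and \<kappa>: "\<kappa> \<in> Hom C K X"
    and ker: "\<And>W z. z \<in> Hom C W X \<Longrightarrow> f \<cdot> z = zero_map W T \<Longrightarrow> \<exists>k \<in> Hom C W K. \<kappa> \<cdot> k = z"
    and st: "s \<in> Hom C W X" "t \<in> Hom C W X" "f \<cdot> s = f \<cdot> t"
  obtains k where "k \<in> Hom C W K" "s \<oplus> \<kappa> \<cdot> k = t"
proof -
  note [simp] = HomD[OF f(1)] f(2,3) HomD[OF st(1)] HomD[OF st(2)]
  have "f \<cdot> (neg s \<oplus> t) = neg (f \<cdot> s) \<oplus> f \<cdot> t" by simp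
  also have "\<dots> = zero_map W T" unfolding st(3) by simp
  finally obtain k where "k \<in> Hom C W K" "\<kappa> \<cdot> k = neg s \<oplus> t"
    using ker[of "neg s \<oplus> t" W] by auto
  then show ?thesis using that add_diff[OF st(1,2)] by simp
qed

end

section \<open>Images and quotients\<close>

locale regular_unital_category = unital_category C
  for C :: "('o, 'm) cat" (structure) +
  assumes regular: "regular_category C"
begin

lemma regular_epi_pullback:
  "is_pullback C g f p q \<Longrightarrow> regular_epi C f \<Longrightarrow> regular_epi C p"
  using regular unfolding regular_category_def by blast

text \<open>
  The quotient e of X by the kernel pair of f is the image. The induced arrow m is a monomorphism:
  two elements of the image that m identifies lift, over a common cover, to elements of X that f
  identifies, and e identifies these too.
\<close>

lemma regular_image:
  assumes f: "f \<in> Hom C X K"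
  obtains I e m where "regular_epi C e" "e \<in> Hom C X I" "m \<in> Hom C I K" "m \<cdot> e = f" "mono_arrow C m"
proof -
  note [simp] = HomD[OF f]
  obtain r1 r2 where R: "is_pullback C f f r1 r2" using pullback_exists[OF fin_complete f f] by blast
  then obtain e where c: "is_coequalizer C r1 r2 e" using regular unfolding regular_category_def by blast
  then have e: "regular_epi C e" unfolding regular_epi_def by blast
  note [simp] = pullbackD(3,4,6-8)[OF R] coequalizerD[OF c]
  obtain m where m: "m \<in> Hom C (Tgt C e) K" "m \<cdot> e = f" by (rule coequalizer_lift[OF c, of f K]) (simp_all add: pullbackD(9)[OF R])
  note [simp] = HomD[OF m(1)]
  have "a = b" if ab: "a \<in> Hom C W (Tgt C e)" "b \<in> Hom C W (Tgt C e)" "m \<cdot> a = m \<cdot> b" for W a b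
  proof -
    note [simp] = HomD[OF ab(1)] HomD[OF ab(2)]
    \<comment> \<open>The cover is built in two steps: over w the element a lifts to x, and over w' also b lifts.\<close>
    obtain w x where w: "is_pullback C a e w x"
      using pullback_exists[OF fin_complete, of a W "Tgt C e" e X] by auto
    note [simp] = pullbackD(3,4,6-8)[OF w]
    obtain w' y where w': "is_pullback C (b \<cdot> w) e w' y"
      using pullback_exists[OF fin_complete, of "b \<cdot> w" "Src C w" "Tgt C e" e X] by auto
    note [simp] = pullbackD(3,4,6-8)[OF w']
    have we: "regular_epi C w" "regular_epi C w'"
      using regular_epi_pullback w w' e by blast+
    let ?s = "x \<cdot> w'"
    have s: "e \<cdot> ?s = a \<cdot> (w \<cdot> w')" using Cmp_reduce[OF pullbackD(9)[OF w], of w'] by simp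
    have t: "e \<cdot> y = b \<cdot> (w \<cdot> w')" using pullbackD(9)[OF w'] by simp
    have "f \<cdot> ?s = m \<cdot> (e \<cdot> ?s)" using Cmp_reduce[OF m(2), of ?s] by simp
    also have "\<dots> = m \<cdot> (e \<cdot> y)"
      unfolding s t using Cmp_reduce[OF ab(3), of "w \<cdot> w'"] by simp
    also have "\<dots> = f \<cdot> y" using Cmp_reduce[OF m(2), of y] by simp
    finally obtain u where u: "u \<in> Hom C (Src C w') (Src C r1)" "r1 \<cdot> u = ?s" "r2 \<cdot> u = y"
      by (rule pullback_lift[OF R, rotated -2]) simp_all
    note [simp] = HomD[OF u(1)]
    have "e \<cdot> ?s = e \<cdot> y"
      unfolding u(2,3)[symmetric] using Cmp_reduce[OF coequalizerD(7)[OF c], of u] by simp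
    then have "(a \<cdot> w) \<cdot> w' = (b \<cdot> w) \<cdot> w'" unfolding s t by simp
    then have "a \<cdot> w = b \<cdot> w" by (rule regular_epi_cancel[OF we(2), rotated -1]) simp_all
    then show ?thesis by (rule regular_epi_cancel[OF we(1), rotated -1]) simp_all
  qed
  then have "mono_arrow C m" unfolding mono_arrow_def by simp
  then show ?thesis by (intro that[OF e _ m(1,2)]) simp_all
qed

text \<open>
  The product of r with the identity of V is a pullback of r, hence a regular epimorphism. Its
  kernel pair is the product of the kernel pair of r with V, and q agrees on the two projections: on
  the first factor because q is g r there, on the second factor trivially.
\<close>

lemma descend_left:
  assumes r: "regular_epi C r" "r \<in> Hom C X K" and V: "V \<in> Obj C"
    and q: "q \<in> Hom C (prod_ob X V) Y" and g: "g \<in> Hom C K Y" "q \<cdot> inl X V = g \<cdot> r"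
  obtains q' where "q' \<in> Hom C (prod_ob K V) Y" "q' \<cdot> pair (r \<cdot> pr1 X V) (pr2 X V) = q"
proof -
  note [simp] = HomD[OF r(2)] V HomD[OF q] HomD[OF g(1)]
  let ?e = "pair (r \<cdot> pr1 X V) (pr2 X V)"
  have "is_pullback C (pr1 K V) r ?e (pr1 X V)"
  proof (rule is_pullbackI[of _ "prod_ob K V" K _ X _ "prod_ob X V"])
    fix T s t assume st: "s \<in> Hom C T (prod_ob K V)" "t \<in> Hom C T X" "pr1 K V \<cdot> s = r \<cdot> t"
    note [simp] = HomD[OF st(1)] HomD[OF st(2)]
    have "?e \<cdot> pair t (pr2 K V \<cdot> s) = s" using pair_eta[of s K V] by (simp add: st(3))
    then show "\<exists>u \<in> Hom C T (prod_ob X V). ?e \<cdot> u = s \<and> pr1 X V \<cdot> u = t"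
      by (intro bexI[of _ "pair t (pr2 K V \<cdot> s)"]) simp_all
  next
    fix T u v assume uv: "u \<in> Hom C T (prod_ob X V)" "v \<in> Hom C T (prod_ob X V)" "?e \<cdot> u = ?e \<cdot> v"
      "pr1 X V \<cdot> u = pr1 X V \<cdot> v"
    note [simp] = HomD[OF uv(1)] HomD[OF uv(2)]
    have "pair (r \<cdot> (pr1 X V \<cdot> u)) (pr2 X V \<cdot> u) = pair (r \<cdot> (pr1 X V \<cdot> v)) (pr2 X V \<cdot> v)"
      using uv(3) by simp
    then have "pr2 X V \<cdot> u = pr2 X V \<cdot> v" by (rule pair_eqD[of _ _ _ _ T K V]) simp_all
    with uv(4) show "u = v" by (intro pair_ext[of u T X V]) simp_all
  qed simp_all
  then have e: "regular_epi C ?e" using r(1) by (rule regular_epi_pullback)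
  obtain r1 r2 where R: "is_pullback C r r r1 r2" using pullback_exists[OF fin_complete r(2) r(2)] by blast
  note [simp] = pullbackD(3,4,6-8)[OF R]
  let ?R = "Src C r1"
  have qq: "q \<cdot> pair (r1 \<cdot> pr1 ?R V) (pr2 ?R V) = q \<cdot> pair (r2 \<cdot> pr1 ?R V) (pr2 ?R V)"
  proof (rule unital_ext[of _ ?R V Y])
    have "q \<cdot> pair x (zero_map ?R V) = (g \<cdot> r) \<cdot> x" if "x \<in> Hom C ?R X" for x
      using Cmp_reduce[OF g(2), of x] that by simp
    from this[of r1] this[of r2] show "(q \<cdot> pair (r1 \<cdot> pr1 ?R V) (pr2 ?R V)) \<cdot> inl ?R V =
        (q \<cdot> pair (r2 \<cdot> pr1 ?R V) (pr2 ?R V)) \<cdot> inl ?R V"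
      by (simp add: pullbackD(9)[OF R])
  qed simp_all
  show ?thesis
  proof (rule regular_epi_lift[OF e, of q Y])
    fix W s t assume st: "s \<in> Hom C W (Src C ?e)" "t \<in> Hom C W (Src C ?e)" "?e \<cdot> s = ?e \<cdot> t"
    note [simp] = HomD[OF st(1), simplified] HomD[OF st(2), simplified]
    have eq: "pair (r \<cdot> (pr1 X V \<cdot> s)) (pr2 X V \<cdot> s) = pair (r \<cdot> (pr1 X V \<cdot> t)) (pr2 X V \<cdot> t)"
      using st(3) by simp
    have 1: "r \<cdot> (pr1 X V \<cdot> s) = r \<cdot> (pr1 X V \<cdot> t)" and 2: "pr2 X V \<cdot> s = pr2 X V \<cdot> t"
      by (rule pair_eqD[OF eq, of W K V]; simp)+
    obtain u where u: "u \<in> Hom C W ?R" "r1 \<cdot> u = pr1 X V \<cdot> s" "r2 \<cdot> u = pr1 X V \<cdot> t"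
      by (rule pullback_lift[OF R _ _ 1, of W]) simp_all
    note [simp] = HomD[OF u(1)]
    have "(q \<cdot> pair (r1 \<cdot> pr1 ?R V) (pr2 ?R V)) \<cdot> pair u (pr2 X V \<cdot> s) =
        (q \<cdot> pair (r2 \<cdot> pr1 ?R V) (pr2 ?R V)) \<cdot> pair u (pr2 X V \<cdot> s)"
      by (simp only: qq)
    moreover have "(q \<cdot> pair (r1 \<cdot> pr1 ?R V) (pr2 ?R V)) \<cdot> pair u (pr2 X V \<cdot> s) = q \<cdot> s"
      by (simp add: u)
    moreover have "(q \<cdot> pair (r2 \<cdot> pr1 ?R V) (pr2 ?R V)) \<cdot> pair u (pr2 X V \<cdot> s) = q \<cdot> t"
      by (simp add: u 2)
    ultimately show "q \<cdot> s = q \<cdot> t" by simp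
  qed (use that in simp_all)
qed

text \<open>
  The arrow q plays the part of an addition with values in K. It descends along r in each argument
  separately, and the resulting arrow on \<open>K \<times> K\<close> satisfies the unit laws because they hold after r.
\<close>

lemma commutative_if_add_descends:
  assumes r: "regular_epi C r" "r \<in> Hom C X K" and q: "q \<in> Hom C (prod_ob X X) K"
    and qr: "q \<cdot> inl X X = r" "q \<cdot> inr X X = r"
  shows "commutative K"
proof -
  note [simp] = HomD[OF r(2)] HomD[OF q]
  obtain q1 where q1: "q1 \<in> Hom C (prod_ob K X) K" "q1 \<cdot> pair (r \<cdot> pr1 X X) (pr2 X X) = q"
    by (rule descend_left[OF r, of X q K "Idn C K"]) (use qr in simp_all)
  note [simp] = HomD[OF q1(1)]
  have q1r: "q1 \<cdot> pair (r \<cdot> x) y = q \<cdot> pair x y" if "x \<in> Hom C W X" "y \<in> Hom C W X" for x y W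
    using Cmp_reduce[OF q1(2), of "pair x y"] that by simp
  have q1l: "q1 \<cdot> inl K X = Idn C K"
  proof (rule regular_epi_cancel[OF r(1)])
    show "(q1 \<cdot> inl K X) \<cdot> r = Idn C K \<cdot> r"
      using q1r[of "Idn C X" X "zero_map X X"] qr by simp
  qed simp_all
  have q1i: "q1 \<cdot> inr K X = r"
    using q1r[of "zero_map X X" X "Idn C X"] qr by simp
  let ?sw = "q1 \<cdot> pair (pr2 X K) (pr1 X K)"
  obtain m where m: "m \<in> Hom C (prod_ob K K) K" "m \<cdot> pair (r \<cdot> pr1 X K) (pr2 X K) = ?sw"
    by (rule descend_left[OF r, of K ?sw K "Idn C K"]) (use q1i in simp_all)
  note [simp] = HomD[OF m(1)]
  have mr: "m \<cdot> pair (r \<cdot> x) y = q1 \<cdot> pair y x" if "x \<in> Hom C W X" "y \<in> Hom C W K" for x y W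
    using Cmp_reduce[OF m(2), of "pair x y"] that by simp
  have "m \<cdot> inr K K = Idn C K"
    using mr[of "zero_map K X" K "Idn C K"] q1l by simp
  moreover have "m \<cdot> inl K K = Idn C K"
  proof (rule regular_epi_cancel[OF r(1)])
    show "(m \<cdot> inl K K) \<cdot> r = Idn C K \<cdot> r"
      using mr[of "Idn C X" X "zero_map X K"] q1i by simp
  qed simp_all
  ultimately show ?thesis unfolding commutative_def unital_magma_def by (intro exI[of _ m]) simp
qed

lemma quotient_commutative:
  assumes e: "regular_epi C e" "e \<in> Hom C X E" and X: "commutative X"
  shows "commutative E"
proof -
  note [simp] = HomD[OF e(2)] X
  show ?thesis by (rule commutative_if_add_descends[OF e, of "e \<cdot> mult X"]) simp_all
qed

text \<open>
  Inverses in a commutative object are unique, so the class of an inverse depends only on the class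
  of the element.
\<close>

lemma quotient_abelian:
  assumes e: "regular_epi C e" "e \<in> Hom C X E" and X: "abelian X"
  shows "abelian E"
proof -
  note [simp] = HomD[OF e(2)] X
  have [simp]: "commutative E" by (rule quotient_commutative[OF e]) simp
  have e_src: "Src C e = X" by simp
  obtain i where i: "i \<in> Hom C E E" "i \<cdot> e = e \<cdot> neg (Idn C X)"
  proof (rule regular_epi_lift[OF e(1), of "e \<cdot> neg (Idn C X)" E])
    fix W s t assume st: "s \<in> Hom C W (Src C e)" "t \<in> Hom C W (Src C e)" "e \<cdot> s = e \<cdot> t"
    note [simp] = HomD[OF st(1), simplified] HomD[OF st(2), simplified]
    have inv: "e \<cdot> z \<oplus> e \<cdot> neg z = zero_map W E" "e \<cdot> neg z \<oplus> e \<cdot> z = zero_map W E" if "z \<in> Hom C W X" for z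
    proof -
      note [simp] = HomD[OF that]
      have "e \<cdot> (z \<oplus> neg z) = e \<cdot> z \<oplus> e \<cdot> neg z" "e \<cdot> (neg z \<oplus> z) = e \<cdot> neg z \<oplus> e \<cdot> z"
        by (subst Cmp_add; simp)+
      then show "e \<cdot> z \<oplus> e \<cdot> neg z = zero_map W E" "e \<cdot> neg z \<oplus> e \<cdot> z = zero_map W E" by simp_all
    qed
    have "e \<cdot> neg s = e \<cdot> neg t"
    proof (rule add_cancel[of "e \<cdot> s" W E _ _ "e \<cdot> neg s"])
      show "e \<cdot> neg s \<oplus> e \<cdot> s = zero_map W E" by (rule inv) simp
      show "e \<cdot> s \<oplus> e \<cdot> neg s = e \<cdot> s \<oplus> e \<cdot> neg t"
        unfolding inv(1)[OF st(1)[unfolded e_src]] unfolding st(3) by (rule inv(1)[symmetric]) simp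
    qed simp_all
    then show "(e \<cdot> neg (Idn C X)) \<cdot> s = (e \<cdot> neg (Idn C X)) \<cdot> t" by simp
  qed simp_all
  note [simp] = HomD[OF i(1)]
  have "Idn C E \<oplus> i = zero_map E E"
  proof (rule regular_epi_cancel[OF e(1)])
    have "e \<oplus> e \<cdot> neg (Idn C X) = e \<cdot> (Idn C X \<oplus> neg (Idn C X))" by (subst Cmp_add) simp_all
    also have "\<dots> = zero_map X E" by simp
    finally show "(Idn C E \<oplus> i) \<cdot> e = zero_map E E \<cdot> e" using i(2) by simp
  qed simp_all
  then show ?thesis unfolding abelian_def is_inversion_def using i(1) by (intro conjI exI[of _ i]) simp_all
qed

end

section \<open>The abelian reflection\<close>

locale cocomplete_regular_unital_category = regular_unital_category C
  for C :: "('o, 'm) cat" (structure) +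
  assumes cocomplete: "finitely_cocomplete C"
begin

text \<open>
  The coequalizer q of the two inclusions of X into \<open>X \<times> X\<close> makes both of them equal to one arrow
  \<open>\<eta>\<close>, and \<open>commutative_if_add_descends\<close> applies to q once \<open>\<eta>\<close> is known to be a regular epimorphism.
  It is: the image of \<open>\<eta>\<close> contains the restrictions of q to both factors, hence q itself by joint
  strong epimorphicity, so that the image is everything.
\<close>

lemma commutative_reflection:
  assumes X: "X \<in> Obj C"
  obtains K \<eta> where "commutative K" "\<eta> \<in> Hom C X K"
    "\<And>B h. commutative B \<Longrightarrow> h \<in> Hom C X B \<Longrightarrow> \<exists>!k. k \<in> Hom C K B \<and> k \<cdot> \<eta> = h"
proof -
  note [simp] = X
  obtain q where c: "is_coequalizer C (inl X X) (inr X X) q"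
    using coequalizer_exists[OF cocomplete, of "inl X X" X "prod_ob X X" "inr X X"] by auto
  note [simp] = coequalizerD(3)[OF c] coequalizerD(6)[OF c, simplified]
  have q: "regular_epi C q" using c unfolding regular_epi_def by blast
  let ?K = "Tgt C q" and ?\<eta> = "q \<cdot> inl X X"
  note qc = coequalizerD(7)[OF c]
  obtain I e m where e: "regular_epi C e" "e \<in> Hom C X I" and m: "m \<in> Hom C I ?K" "m \<cdot> e = ?\<eta>" "mono_arrow C m"
    by (rule regular_image[of ?\<eta> X ?K]) simp_all
  note [simp] = HomD[OF e(2)] HomD[OF m(1)]
  obtain d where d: "d \<in> Hom C (prod_ob X X) I" "m \<cdot> d = q"
    by (rule unital_fill[OF m(3,1), of q X X e e]) (use m(2) qc in simp_all)
  note [simp] = HomD[OF d(1)]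
  have "m \<cdot> (d \<cdot> inl X X) = m \<cdot> (d \<cdot> inr X X)"
    using Cmp_reduce[OF d(2), of "inl X X"] Cmp_reduce[OF d(2), of "inr X X"] qc by simp
  then have "d \<cdot> inl X X = d \<cdot> inr X X"
    by (rule monoD[OF m(3), of _ _ X]) simp_all
  then obtain s where s: "s \<in> Hom C ?K I" "s \<cdot> q = d"
    by (rule coequalizer_lift[OF c, rotated -2]) simp_all
  note [simp] = HomD[OF s(1)]
  have ms: "m \<cdot> s = Idn C ?K"
    by (rule regular_epi_cancel[OF q]) (use s d in simp_all)
  have sm: "s \<cdot> m = Idn C I"
    by (rule monoD[OF m(3), of _ _ I]) (use Cmp_reduce[OF ms, of m] in simp_all)
  have \<eta>: "regular_epi C ?\<eta>"
    unfolding m(2)[symmetric] by (rule regular_epi_iso_Cmp[OF e(1), of _ ?K s]) (use ms sm in simp_all)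
  have "commutative ?K" by (rule commutative_if_add_descends[OF \<eta>, of X _ q]) (use qc in simp_all)
  moreover have "\<exists>!k. k \<in> Hom C ?K B \<and> k \<cdot> ?\<eta> = h" if B: "commutative B" and h: "h \<in> Hom C X B" for B h
  proof -
    note [simp] = B HomD[OF h]
    obtain k where k: "k \<in> Hom C ?K B" "k \<cdot> q = h \<cdot> pr1 X X \<oplus> h \<cdot> pr2 X X"
      by (rule coequalizer_lift[OF c, of "h \<cdot> pr1 X X \<oplus> h \<cdot> pr2 X X" B]) simp_all
    note [simp] = HomD[OF k(1)]
    have k\<eta>: "k \<cdot> ?\<eta> = h" using Cmp_reduce[OF k(2), of "inl X X"] by simp
    show ?thesis
    proof (rule ex1I[of _ k], intro conjI k(1) k\<eta>)
      fix l assume l: "l \<in> Hom C ?K B \<and> l \<cdot> ?\<eta> = h"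
      show "l = k" by (rule regular_epi_cancel[OF \<eta>]) (use l k\<eta> in simp_all)
    qed
  qed
  ultimately show ?thesis using that[of ?K ?\<eta>] by simp
qed

text \<open>
  The group completion: the cokernel q of the diagonal consists of formal differences, with (x, y)
  standing for x minus y. Swapping the components gives the inversion, and h extends to (x, y) by
  h x minus h y. The universal arrow a need not be a regular epimorphism (think of the
  natural numbers inside the integers), but an extension l is determined by l a because the second
  restriction b of q is the negative of a.
\<close>

lemma commutative_abelian_reflection:
  assumes K: "commutative K"
  obtains A a where "abelian A" "a \<in> Hom C K A"
    "\<And>B h. abelian B \<Longrightarrow> h \<in> Hom C K B \<Longrightarrow> \<exists>!k. k \<in> Hom C A B \<and> k \<cdot> a = h"
proof -
  note [simp] = K
  let ?KK = "prod_ob K K" and ?\<Delta> = "pair (Idn C K) (Idn C K)"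
  obtain q where c: "is_coequalizer C ?\<Delta> (zero_map K ?KK) q"
    using coequalizer_exists[OF cocomplete, of ?\<Delta> K ?KK "zero_map K ?KK"] by auto
  note [simp] = coequalizerD(3)[OF c] coequalizerD(6)[OF c, simplified]
  have q: "regular_epi C q" using c unfolding regular_epi_def by blast
  let ?A = "Tgt C q" and ?a = "q \<cdot> inl K K" and ?b = "q \<cdot> inr K K"
  have q\<Delta>: "q \<cdot> ?\<Delta> = zero_map K ?A" using coequalizerD(7)[OF c] by simp
  let ?Q = "q \<cdot> pair (pr1 K K \<cdot> pr1 ?KK ?KK \<oplus> pr1 K K \<cdot> pr2 ?KK ?KK)
                    (pr2 K K \<cdot> pr1 ?KK ?KK \<oplus> pr2 K K \<cdot> pr2 ?KK ?KK)"
  have [simp]: "commutative ?A" by (rule commutative_if_add_descends[OF q, of ?KK _ ?Q]) simp_all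
  have qab: "q \<cdot> pair x y = ?a \<cdot> x \<oplus> ?b \<cdot> y" if "x \<in> Hom C W K" "y \<in> Hom C W K" for W x y
    by (rule Cmp_pair_eq_add[where X = ?A and W = W]) (use that in simp_all)
  have ab: "?a \<cdot> x \<oplus> ?b \<cdot> x = zero_map W ?A" if x: "x \<in> Hom C W K" for W x
  proof -
    note [simp] = HomD[OF x]
    have "q \<cdot> (?\<Delta> \<cdot> x) = zero_map K ?A \<cdot> x" by (rule Cmp_reduce[OF q\<Delta>]) simp_all
    then show ?thesis using qab[OF x x] by simp
  qed
  let ?sw = "pair (pr2 K K) (pr1 K K)"
  obtain i where i: "i \<in> Hom C ?A ?A" "i \<cdot> q = q \<cdot> ?sw"
    by (rule coequalizer_lift[OF c, of "q \<cdot> ?sw" ?A]) (use q\<Delta> in simp_all)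
  note [simp] = HomD[OF i(1)]
  have "Idn C ?A \<oplus> i = zero_map ?A ?A"
  proof (rule regular_epi_cancel[OF q])
    let ?x = "pr1 K K" and ?y = "pr2 K K"
    have "(Idn C ?A \<oplus> i) \<cdot> q = q \<cdot> pair ?x ?y \<oplus> q \<cdot> ?sw" using i by simp
    also have "\<dots> = (?a \<cdot> ?x \<oplus> ?b \<cdot> ?y) \<oplus> (?a \<cdot> ?y \<oplus> ?b \<cdot> ?x)"
      by (subst (1 2) qab[of _ ?KK]) simp_all
    also have "\<dots> = ?a \<cdot> ?x \<oplus> (?b \<cdot> ?y \<oplus> (?a \<cdot> ?y \<oplus> ?b \<cdot> ?x))"
      by (rule add_assoc[of _ ?KK ?A]) simp_all
    also have "?b \<cdot> ?y \<oplus> (?a \<cdot> ?y \<oplus> ?b \<cdot> ?x) = (?b \<cdot> ?y \<oplus> ?a \<cdot> ?y) \<oplus> ?b \<cdot> ?x"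
      by (rule add_assoc[of _ ?KK ?A, symmetric]) simp_all
    also have "?b \<cdot> ?y \<oplus> ?a \<cdot> ?y = ?a \<cdot> ?y \<oplus> ?b \<cdot> ?y"
      by (rule add_commute[of _ ?KK ?A]) simp_all
    also have "?a \<cdot> ?y \<oplus> ?b \<cdot> ?y = zero_map ?KK ?A" by (rule ab) simp
    also have "zero_map ?KK ?A \<oplus> ?b \<cdot> ?x = ?b \<cdot> ?x" by simp
    also have "?a \<cdot> ?x \<oplus> ?b \<cdot> ?x = zero_map ?KK ?A" by (rule ab) simp
    also have "\<dots> = zero_map ?A ?A \<cdot> q" by simp
    finally show "(Idn C ?A \<oplus> i) \<cdot> q = zero_map ?A ?A \<cdot> q" .
  qed simp_all
  then have "abelian ?A" unfolding abelian_def is_inversion_def using i(1) by (intro conjI exI[of _ i]) simp_all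
  moreover have "\<exists>!k. k \<in> Hom C ?A B \<and> k \<cdot> ?a = h" if B: "abelian B" and h: "h \<in> Hom C K B" for B h
  proof -
    note [simp] = B HomD[OF h]
    let ?g = "h \<cdot> pr1 K K \<oplus> neg (h \<cdot> pr2 K K)"
    obtain k where k: "k \<in> Hom C ?A B" "k \<cdot> q = ?g"
      by (rule coequalizer_lift[OF c, of ?g B]) simp_all
    note [simp] = HomD[OF k(1)]
    have ka: "k \<cdot> ?a = h" using Cmp_reduce[OF k(2), of "inl K K"] by simp
    show ?thesis
    proof (rule ex1I[of _ k], intro conjI k(1) ka)
      fix l assume l: "l \<in> Hom C ?A B \<and> l \<cdot> ?a = h"
      have opp: "h \<oplus> n \<cdot> ?b = zero_map K B" if n: "n \<in> Hom C ?A B" "n \<cdot> ?a = h" for n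
      proof -
        note [simp] = HomD[OF n(1)]
        have "n \<cdot> ?a \<oplus> n \<cdot> ?b = n \<cdot> (?a \<oplus> ?b)" by (rule Cmp_add[symmetric]) simp_all
        also have "?a \<oplus> ?b = zero_map K ?A" using ab[of "Idn C K" K] by simp
        finally show ?thesis using n(2) by simp
      qed
      have lkb: "l \<cdot> ?b = k \<cdot> ?b"
        by (rule abelian_cancel[of h K B]) (use opp[of l] opp[OF k(1) ka] l in simp_all)
      show "l = k"
      proof (rule regular_epi_cancel[OF q])
        show "l \<cdot> q = k \<cdot> q"
          by (rule unital_ext[of _ K K B]) (use lkb l ka in simp_all)
      qed (use l in simp_all)
    qed
  qed
  ultimately show ?thesis using that[of ?A ?a] by simp
qed

text \<open>
  The reflection unit of a single object, independent of a global choice of reflections.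
\<close>

definition ab_unit :: "'o \<Rightarrow> 'o \<Rightarrow> 'm \<Rightarrow> bool" where
  "ab_unit X A \<eta> \<longleftrightarrow> abelian A \<and> \<eta> \<in> Hom C X A \<and>
     (\<forall>B h. abelian B \<longrightarrow> h \<in> Hom C X B \<longrightarrow> (\<exists>!k. k \<in> Hom C A B \<and> k \<cdot> \<eta> = h))"

lemma ab_unit_exists:
  assumes X: "X \<in> Obj C"
  obtains A \<eta> where "ab_unit X A \<eta>"
proof -
  obtain K \<eta> where K: "commutative K" "\<eta> \<in> Hom C X K"
    and uK: "\<And>B h. commutative B \<Longrightarrow> h \<in> Hom C X B \<Longrightarrow> \<exists>!k. k \<in> Hom C K B \<and> k \<cdot> \<eta> = h"
    by (rule commutative_reflection[OF X]) blast
  obtain A a where A: "abelian A" "a \<in> Hom C K A"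
    and uA: "\<And>B h. abelian B \<Longrightarrow> h \<in> Hom C K B \<Longrightarrow> \<exists>!k. k \<in> Hom C A B \<and> k \<cdot> a = h"
    by (rule commutative_abelian_reflection[OF K(1)]) blast
  note [simp] = HomD[OF K(2)] HomD[OF A(2)]
  have *: "\<exists>!k. k \<in> Hom C A B \<and> k \<cdot> (a \<cdot> \<eta>) = h" if B: "abelian B" "h \<in> Hom C X B" for B h
  proof -
    obtain l where l: "l \<in> Hom C K B" "l \<cdot> \<eta> = h" "\<And>l'. l' \<in> Hom C K B \<Longrightarrow> l' \<cdot> \<eta> = h \<Longrightarrow> l' = l"
      using uK[of B h] B by auto
    obtain k where k: "k \<in> Hom C A B" "k \<cdot> a = l" "\<And>k'. k' \<in> Hom C A B \<Longrightarrow> k' \<cdot> a = l \<Longrightarrow> k' = k"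
      using uA[OF B(1) l(1)] by blast
    note [simp] = HomD[OF k(1)] HomD[OF l(1)]
    show ?thesis
    proof (rule ex1I[of _ k], intro conjI k(1))
      show "k \<cdot> (a \<cdot> \<eta>) = h" using Cmp_reduce[OF k(2), of \<eta>] l(2) by simp
      show "k' = k" if k': "k' \<in> Hom C A B \<and> k' \<cdot> (a \<cdot> \<eta>) = h" for k'
        by (rule k(3), use k' in blast, rule l(3)) (use k' in simp_all)
    qed
  qed
  have "ab_unit X A (a \<cdot> \<eta>)"
    unfolding ab_unit_def by (intro conjI allI impI *) (use A in simp_all)
  then show ?thesis using that by blast
qed

lemma ab_unitD:
  assumes "ab_unit X A \<eta>"
  shows "abelian A" "\<eta> \<in> Arr C" "Src C \<eta> = X" "Tgt C \<eta> = A" "X \<in> Obj C"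
  using assms by (auto simp: ab_unit_def)

lemma ab_unit_lift:
  assumes "ab_unit X A \<eta>" "abelian B" "h \<in> Hom C X B"
  obtains k where "k \<in> Hom C A B" "k \<cdot> \<eta> = h"
  using assms unfolding ab_unit_def by blast

lemma ab_unit_cancel:
  assumes u: "ab_unit X A \<eta>" and B: "abelian B" and k: "k \<in> Hom C A B" "k' \<in> Hom C A B" "k \<cdot> \<eta> = k' \<cdot> \<eta>"
  shows "k = k'"
proof -
  have "k' \<cdot> \<eta> \<in> Hom C X B" using k(2) ab_unitD[OF u] by simp
  then have "\<exists>!l. l \<in> Hom C A B \<and> l \<cdot> \<eta> = k' \<cdot> \<eta>" using u B unfolding ab_unit_def by blast
  then show ?thesis using k by blast
qed

end

section \<open>Normality of monomorphisms between abelian objects\<close>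

locale exact_unital_category = cocomplete_regular_unital_category C
  for C :: "('o, 'm) cat" (structure) +
  assumes exact: "barr_exact C"
begin

text \<open>
  Addition of elements of K yields an equivalence relation on Z, carried by \<open>Z \<times> K\<close> with the
  projection (z, k) to z and the action (z, k) to \<open>z + \<nu> k\<close>. By exactness it is the kernel pair of its
  coequalizer e, so an element that e kills is related to 0, that is, it comes from K.
\<close>

lemma mono_is_normal:
  assumes \<nu>: "\<nu> \<in> Hom C K Z" "mono_arrow C \<nu>" and abelian: "abelian K" "abelian Z"
  obtains E e where "abelian E" "e \<in> Hom C Z E" "e \<cdot> \<nu> = zero_map K E"
    "\<And>W t. t \<in> Hom C W Z \<Longrightarrow> e \<cdot> t = zero_map W E \<Longrightarrow> \<exists>k \<in> Hom C W K. \<nu> \<cdot> k = t"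
proof -
  note [simp] = HomD[OF \<nu>(1)] abelian
  let ?R = "prod_ob Z K" and ?r1 = "pr1 Z K" and ?r2 = "pr1 Z K \<oplus> \<nu> \<cdot> pr2 Z K"
  have "equivalence_relation C Z ?R ?r1 ?r2"
    unfolding equivalence_relation_def
  proof (intro conjI ballI impI)
    fix T x y assume xy: "x \<in> Hom C T ?R" "y \<in> Hom C T ?R" "?r1 \<cdot> x = ?r1 \<cdot> y" "?r2 \<cdot> x = ?r2 \<cdot> y"
    note [simp] = HomD[OF xy(1)] HomD[OF xy(2)]
    have "?r1 \<cdot> y \<oplus> \<nu> \<cdot> (pr2 Z K \<cdot> x) = ?r1 \<cdot> y \<oplus> \<nu> \<cdot> (pr2 Z K \<cdot> y)" using xy(3,4) by simp
    then have "\<nu> \<cdot> (pr2 Z K \<cdot> x) = \<nu> \<cdot> (pr2 Z K \<cdot> y)"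
      by (rule abelian_cancel[where W = T and A = Z, rotated -1]) simp_all
    then have "pr2 Z K \<cdot> x = pr2 Z K \<cdot> y" by (rule monoD[OF \<nu>(2), of _ _ T]) simp_all
    then show "x = y" by (intro pair_ext[OF xy(1,2,3)]) simp_all
  next
    show "\<exists>d \<in> Hom C Z ?R. ?r1 \<cdot> d = Idn C Z \<and> ?r2 \<cdot> d = Idn C Z"
      by (intro bexI[of _ "inl Z K"]) simp_all
  next
    have "?r2 \<oplus> \<nu> \<cdot> neg (pr2 Z K) = ?r1 \<oplus> (\<nu> \<cdot> pr2 Z K \<oplus> \<nu> \<cdot> neg (pr2 Z K))"
      by (rule add_assoc[of _ ?R Z]) simp_all
    then show "\<exists>s \<in> Hom C ?R ?R. ?r1 \<cdot> s = ?r2 \<and> ?r2 \<cdot> s = ?r1"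
      by (intro bexI[of _ "pair ?r2 (neg (pr2 Z K))"]) simp_all
  next
    obtain t1 t2 where t: "is_pullback C ?r2 ?r1 t1 t2"
      using pullback_exists[OF fin_complete, of ?r2 ?R Z ?r1 ?R] by auto
    note [simp] = pullbackD(3,4)[OF t] pullbackD(6-8)[OF t, simplified]
    let ?W = "Src C t1"
    let ?t = "pair (?r1 \<cdot> t1) (pr2 Z K \<cdot> t1 \<oplus> pr2 Z K \<cdot> t2)"
    have "?r1 \<cdot> t1 \<oplus> (\<nu> \<cdot> (pr2 Z K \<cdot> t1) \<oplus> \<nu> \<cdot> (pr2 Z K \<cdot> t2)) =
        ?r1 \<cdot> t1 \<oplus> \<nu> \<cdot> (pr2 Z K \<cdot> t1) \<oplus> \<nu> \<cdot> (pr2 Z K \<cdot> t2)"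
      by (rule add_assoc[of _ ?W Z, symmetric]) simp_all
    also have "\<dots> = ?r2 \<cdot> t1 \<oplus> \<nu> \<cdot> (pr2 Z K \<cdot> t2)" by simp
    also have "\<dots> = ?r1 \<cdot> t2 \<oplus> \<nu> \<cdot> (pr2 Z K \<cdot> t2)" unfolding pullbackD(9)[OF t] ..
    finally have "?r2 \<cdot> ?t = ?r2 \<cdot> t2" by simp
    then have "?t \<in> Hom C ?W ?R \<and> ?r1 \<cdot> ?t = ?r1 \<cdot> t1 \<and> ?r2 \<cdot> ?t = ?r2 \<cdot> t2" by simp
    with t show "\<exists>t1 t2. is_pullback C ?r2 ?r1 t1 t2 \<and>
        (\<exists>t \<in> Hom C (Src C t1) ?R. ?r1 \<cdot> t = ?r1 \<cdot> t1 \<and> ?r2 \<cdot> t = ?r2 \<cdot> t2)"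
      by blast
  qed simp_all
  then obtain f0 where f0: "is_pullback C f0 f0 ?r1 ?r2" using exact unfolding barr_exact_def by blast
  then obtain e where c: "is_coequalizer C ?r1 ?r2 e" using regular unfolding regular_category_def by blast
  then have re: "regular_epi C e" unfolding regular_epi_def by blast
  note f0D = pullbackD[OF f0] and cD = coequalizerD[OF c]
  have [simp]: "e \<in> Arr C" "Src C e = Z" "f0 \<in> Arr C" "Src C f0 = Z"
    using cD(3,6) f0D(2,8) by simp_all
  let ?E = "Tgt C e"
  have E [simp]: "abelian ?E" by (rule quotient_abelian[OF re, of Z]) simp_all
  \<comment> \<open>The relation is the kernel pair of f0, and f0 factors through e, so elements identified by e are
    related.\<close>
  obtain g where g: "g \<in> Hom C ?E (Tgt C f0)" "g \<cdot> e = f0"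
    by (rule coequalizer_lift[OF c _ f0D(9)[symmetric], of "Tgt C f0"]) simp_all
  note [simp] = HomD[OF g(1)]
  have "(e \<cdot> ?r1) \<cdot> inr Z K = (e \<cdot> ?r2) \<cdot> inr Z K" by (simp only: cD(7))
  then have "e \<cdot> \<nu> = zero_map K ?E" by simp
  moreover have "\<exists>k \<in> Hom C W K. \<nu> \<cdot> k = t" if t: "t \<in> Hom C W Z" "e \<cdot> t = zero_map W ?E" for W t
  proof -
    note [simp] = HomD[OF t(1)]
    have "f0 \<cdot> zero_map W Z = f0 \<cdot> t" using Cmp_reduce[OF g(2), of t] t(2) by simp
    then obtain u where u: "u \<in> Hom C W ?R" "?r1 \<cdot> u = zero_map W Z" "?r2 \<cdot> u = t"
      by (rule pullback_lift[OF f0, where T = W, rotated -2]) simp_all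
    note [simp] = HomD[OF u(1)]
    have "?r2 \<cdot> u = ?r1 \<cdot> u \<oplus> \<nu> \<cdot> (pr2 Z K \<cdot> u)" by simp
    also have "\<dots> = \<nu> \<cdot> (pr2 Z K \<cdot> u)" unfolding u(2) by simp
    finally show ?thesis using u(3) by (intro bexI[of _ "pr2 Z K \<cdot> u"]) simp_all
  qed
  ultimately show ?thesis by (intro that[of ?E e]) simp_all
qed

end

section \<open>Pulling back a reflection unit\<close>

context exact_unital_category
begin

text \<open>
  The comparison c from the reflection A of P to X is shown to be invertible, by applying normality of
  monomorphisms first to K inside A and then to A inside X.
\<close>

lemma pullback_of_unit_is_unit:
  assumes \<eta>: "ab_unit B T \<eta>" and f: "f \<in> Hom C X T" "regular_epi C f" "abelian X"
    and pb: "is_pullback C \<eta> f p q"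
  shows "ab_unit (Src C p) X q"
proof -
  let ?P = "Src C p"
  note [simp] = ab_unitD[OF \<eta>] HomD[OF f(1)] f(3) pullbackD(3,4)[OF pb] pullbackD(6-8)[OF pb, simplified]
  have fq: "f \<cdot> q = \<eta> \<cdot> p" using pullbackD(9)[OF pb] .
  have p: "regular_epi C p" by (rule regular_epi_pullback[OF pb f(2)])
  obtain A a where a: "ab_unit ?P A a" by (rule ab_unit_exists[of ?P]) simp_all
  note [simp] = ab_unitD(1-4)[OF a]
  obtain c where c: "c \<in> Hom C A X" "c \<cdot> a = q" by (rule ab_unit_lift[OF a, of X q]) simp_all
  note [simp] = HomD[OF c(1)]
  obtain K \<kappa> where K: "abelian K" "\<kappa> \<in> Hom C K X" "mono_arrow C \<kappa>" "f \<cdot> \<kappa> = zero_map K T"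
    and ker: "\<And>W z. z \<in> Hom C W X \<Longrightarrow> f \<cdot> z = zero_map W T \<Longrightarrow> \<exists>k \<in> Hom C W K. \<kappa> \<cdot> k = z"
    by (rule kernel_exists[OF f(1)]) (simp, simp, blast)
  note [simp] = K(1) HomD[OF K(2)]
  obtain \<iota> where \<iota>: "\<iota> \<in> Hom C K ?P" "p \<cdot> \<iota> = zero_map K B" "q \<cdot> \<iota> = \<kappa>"
    by (rule pullback_lift[OF pb, of "zero_map K B" K \<kappa>]) (use K(4) in simp_all)
  note [simp] = HomD[OF \<iota>(1)]
  let ?j = "a \<cdot> \<iota>"
  have cj: "c \<cdot> ?j = \<kappa>" using Cmp_reduce[OF c(2), of \<iota>] \<iota>(3) by simp
  have ctriv: "z = zero_map W K" if "z \<in> Hom C W K" "\<kappa> \<cdot> z = zero_map W X" for W z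
    by (rule monoD[OF K(3), of _ _ W]) (use that HomD[OF that(1)] in simp_all)
  \<comment> \<open>K embeds into A because it embeds into X.\<close>
  have j: "mono_arrow C ?j"
  proof (rule mono_if_trivial_kernel[of _ K A])
    fix W z assume z: "z \<in> Hom C W K" "?j \<cdot> z = zero_map W A"
    note [simp] = HomD[OF z(1)]
    have "c \<cdot> (?j \<cdot> z) = \<kappa> \<cdot> z" using Cmp_reduce[OF cj, of z] by simp
    then show "z = zero_map W K" using z by (intro ctriv) simp_all
  qed simp_all
  \<comment> \<open>The action of K on P, which a turns into addition.\<close>
  obtain \<sigma> where \<sigma>: "\<sigma> \<in> Hom C (prod_ob ?P K) ?P" "p \<cdot> \<sigma> = p \<cdot> pr1 ?P K"
      "q \<cdot> \<sigma> = q \<cdot> pr1 ?P K \<oplus> \<kappa> \<cdot> pr2 ?P K"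
  proof (rule pullback_lift[OF pb, of "p \<cdot> pr1 ?P K" "prod_ob ?P K" "q \<cdot> pr1 ?P K \<oplus> \<kappa> \<cdot> pr2 ?P K"])
    show "\<eta> \<cdot> (p \<cdot> pr1 ?P K) = f \<cdot> (q \<cdot> pr1 ?P K \<oplus> \<kappa> \<cdot> pr2 ?P K)"
      using Cmp_reduce[OF fq, of "pr1 ?P K"] Cmp_reduce[OF K(4), of "pr2 ?P K"] by simp
  qed simp_all
  note [simp] = HomD[OF \<sigma>(1)]
  have \<sigma>pair: "p \<cdot> (\<sigma> \<cdot> pair s k) = p \<cdot> s" "q \<cdot> (\<sigma> \<cdot> pair s k) = q \<cdot> s \<oplus> \<kappa> \<cdot> k"
    if "s \<in> Hom C W ?P" "k \<in> Hom C W K" for W s k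
    using Cmp_reduce[OF \<sigma>(2), of "pair s k"] Cmp_reduce[OF \<sigma>(3), of "pair s k"] that by simp_all
  have \<sigma>l: "\<sigma> \<cdot> inl ?P K = Idn C ?P"
    by (rule pullback_ext[OF pb, of _ ?P]) (use \<sigma>pair[of "Idn C ?P" ?P "zero_map ?P K"] in simp_all)
  have \<sigma>r: "\<sigma> \<cdot> inr ?P K = \<iota>"
    by (rule pullback_ext[OF pb, of _ K]) (use \<sigma>pair[of "zero_map K ?P" K "Idn C K"] \<iota> in simp_all)
  have a\<sigma>: "a \<cdot> (\<sigma> \<cdot> pair s k) = a \<cdot> s \<oplus> ?j \<cdot> k" if sk: "s \<in> Hom C W ?P" "k \<in> Hom C W K" for W s k
  proof -
    note [simp] = HomD[OF sk(1)] HomD[OF sk(2)]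
    have "(a \<cdot> \<sigma>) \<cdot> pair s k = ((a \<cdot> \<sigma>) \<cdot> inl ?P K) \<cdot> s \<oplus> ((a \<cdot> \<sigma>) \<cdot> inr ?P K) \<cdot> k"
      by (rule Cmp_pair_eq_add[where X = A and W = W]) simp_all
    then show ?thesis using \<sigma>l \<sigma>r by simp
  qed
  obtain Q e where Q: "abelian Q" "e \<in> Hom C A Q" "e \<cdot> ?j = zero_map K Q"
    and eker: "\<And>W t. t \<in> Hom C W A \<Longrightarrow> e \<cdot> t = zero_map W Q \<Longrightarrow> \<exists>k \<in> Hom C W K. ?j \<cdot> k = t"
    by (rule mono_is_normal[of ?j K A]) (use j in \<open>simp, simp, simp, simp, blast\<close>)
  note [simp] = Q(1) HomD[OF Q(2)]
  \<comment> \<open>Elements of P with the same image under p lie in one orbit of K, on which e a is constant.\<close>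
  obtain \<psi> where \<psi>: "\<psi> \<in> Hom C B Q" "\<psi> \<cdot> p = e \<cdot> a"
  proof (rule regular_epi_lift[OF p, of "e \<cdot> a" Q])
    fix W s t assume st: "s \<in> Hom C W ?P" "t \<in> Hom C W ?P" "p \<cdot> s = p \<cdot> t"
    note [simp] = HomD[OF st(1)] HomD[OF st(2)]
    have "f \<cdot> (q \<cdot> s) = f \<cdot> (q \<cdot> t)"
      using Cmp_reduce[OF fq, of s] Cmp_reduce[OF fq, of t] st(3) by simp
    then obtain k where k: "k \<in> Hom C W K" "q \<cdot> s \<oplus> \<kappa> \<cdot> k = q \<cdot> t"
      by (rule kernel_difference[OF f(1,3) _ K(2) ker, where W = W, rotated -2]) simp_all
    note [simp] = HomD[OF k(1)]
    have "\<sigma> \<cdot> pair s k = t"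
      by (rule pullback_ext[OF pb, of _ W]) (use \<sigma>pair[OF st(1) k(1)] k(2) st(3) in simp_all)
    then have "e \<cdot> (a \<cdot> t) = e \<cdot> (a \<cdot> s \<oplus> ?j \<cdot> k)" using a\<sigma>[OF st(1) k(1)] by simp
    also have "\<dots> = e \<cdot> (a \<cdot> s) \<oplus> e \<cdot> (?j \<cdot> k)" by (rule Cmp_add) simp_all
    also have "\<dots> = e \<cdot> (a \<cdot> s)" using Cmp_reduce[OF Q(3), of k] by simp
    finally show "(e \<cdot> a) \<cdot> s = (e \<cdot> a) \<cdot> t" by simp
  qed simp_all
  obtain \<phi> where \<phi>: "\<phi> \<in> Hom C T Q" "\<phi> \<cdot> \<eta> = \<psi>" by (rule ab_unit_lift[OF \<eta> Q(1) \<psi>(1)])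
  note [simp] = HomD[OF \<psi>(1)] HomD[OF \<phi>(1)]
  have e_eq: "e = \<phi> \<cdot> (f \<cdot> c)"
  proof (rule ab_unit_cancel[OF a Q(1)])
    show "e \<cdot> a = (\<phi> \<cdot> (f \<cdot> c)) \<cdot> a"
      using Cmp_reduce[OF \<phi>(2), of p] \<psi>(2) c(2) fq by simp
  qed simp_all
  \<comment> \<open>Whatever c kills is killed by e, hence comes from K, where c restricts to a monomorphism.\<close>
  have c_mono: "mono_arrow C c"
  proof (rule mono_if_trivial_kernel[of c A X])
    fix W z assume z: "z \<in> Hom C W A" "c \<cdot> z = zero_map W X"
    note [simp] = HomD[OF z(1)]
    have "e \<cdot> z = zero_map W Q" unfolding e_eq using z(2) by simp
    then obtain k where k: "k \<in> Hom C W K" "?j \<cdot> k = z" using eker[OF z(1)] by blast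
    note [simp] = HomD[OF k(1)]
    have "\<kappa> \<cdot> k = zero_map W X" using Cmp_reduce[OF cj, of k] k(2) z(2) by simp
    then have "k = zero_map W K" by (intro ctriv k(1))
    then show "z = zero_map W A" using k(2) by simp
  qed simp_all
  obtain Q' e' where Q': "abelian Q'" "e' \<in> Hom C X Q'" "e' \<cdot> c = zero_map A Q'"
    and e'ker: "\<And>W t. t \<in> Hom C W X \<Longrightarrow> e' \<cdot> t = zero_map W Q' \<Longrightarrow> \<exists>k \<in> Hom C W A. c \<cdot> k = t"
    by (rule mono_is_normal[OF c(1) c_mono]) (simp, simp, blast)
  note [simp] = Q'(1) HomD[OF Q'(2)]
  have e'\<kappa>: "e' \<cdot> \<kappa> = zero_map K Q'" using Cmp_reduce[OF Q'(3), of ?j] cj by simp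
  \<comment> \<open>The arrow e' kills the kernel of f, so it descends along f.\<close>
  obtain l where l: "l \<in> Hom C T Q'" "l \<cdot> f = e'"
  proof (rule regular_epi_lift[OF f(2), of e' Q'])
    fix W s t assume st: "s \<in> Hom C W (Src C f)" "t \<in> Hom C W (Src C f)" "f \<cdot> s = f \<cdot> t"
    then have st': "s \<in> Hom C W X" "t \<in> Hom C W X" by simp_all
    note [simp] = HomD[OF st'(1)] HomD[OF st'(2)]
    obtain k where k: "k \<in> Hom C W K" "s \<oplus> \<kappa> \<cdot> k = t"
      by (rule kernel_difference[OF f(1,3) _ K(2) ker st' st(3)]) simp_all
    note [simp] = HomD[OF k(1)]
    have "e' \<cdot> (s \<oplus> \<kappa> \<cdot> k) = e' \<cdot> s \<oplus> e' \<cdot> (\<kappa> \<cdot> k)" by (rule Cmp_add) simp_all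
    then show "e' \<cdot> s = e' \<cdot> t" using Cmp_reduce[OF e'\<kappa>, of k] k(2) by simp
  qed simp_all
  note [simp] = HomD[OF l(1)]
  have "l \<cdot> \<eta> = zero_map B Q'"
  proof (rule regular_epi_cancel[OF p])
    have "(l \<cdot> \<eta>) \<cdot> p = l \<cdot> (f \<cdot> q)" using fq by simp
    also have "\<dots> = e' \<cdot> q" using Cmp_reduce[OF l(2), of q] by simp
    also have "\<dots> = zero_map ?P Q'" using Cmp_reduce[OF Q'(3), of a] c(2) by simp
    finally show "(l \<cdot> \<eta>) \<cdot> p = zero_map B Q' \<cdot> p" by simp
  qed simp_all
  then have "l = zero_map T Q'" by (intro ab_unit_cancel[OF \<eta> Q'(1) l(1)]) simp_all
  then have "e' = zero_map X Q'" using l(2) by simp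
  then obtain s where s: "s \<in> Hom C X A" "c \<cdot> s = Idn C X" using e'ker[of "Idn C X" X] by auto
  note [simp] = HomD[OF s(1)]
  have sc: "s \<cdot> c = Idn C A"
    by (rule monoD[OF c_mono, of _ _ A]) (use Cmp_reduce[OF s(2), of c] in simp_all)
  have *: "\<exists>!k. k \<in> Hom C X Y \<and> k \<cdot> q = h" if Y: "abelian Y" and h: "h \<in> Hom C ?P Y" for Y h
  proof -
    obtain k where k: "k \<in> Hom C A Y" "k \<cdot> a = h" by (rule ab_unit_lift[OF a Y h])
    note [simp] = HomD[OF k(1)]
    show ?thesis
    proof (rule ex1I[of _ "k \<cdot> s"], intro conjI)
      show "(k \<cdot> s) \<cdot> q = h"
        using Cmp_reduce[OF sc, of a] c(2) k(2) by simp
    next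
      fix k' assume k': "k' \<in> Hom C X Y \<and> k' \<cdot> q = h"
      then have [simp]: "k' \<in> Arr C" "Src C k' = X" "Tgt C k' = Y" by simp_all
      have "k' \<cdot> c = k"
        by (rule ab_unit_cancel[OF a Y]) (use k' c(2) k(2) in simp_all)
      then show "k' = k \<cdot> s" using Cmp_reduce[of k' c k s] s(2) by simp
    qed simp
  qed
  show ?thesis unfolding ab_unit_def by (intro conjI allI impI *) simp_all
qed

end

section \<open>Slices and the abelian core as categories\<close>

lemma category_full_subcat:
  assumes "category C"
  shows "category (full_subcat C S)"
proof -
  interpret category C by fact
  let ?D = "full_subcat C S"
  have sub: "f \<in> Hom ?D A B \<longleftrightarrow> f \<in> Hom C A B \<and> S A \<and> S B" for f A B
    by (auto simp: full_subcat_def Hom_def)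
  have ops: "Cmp ?D = Cmp C" "Idn ?D = Idn C" "Src ?D = Src C" "Tgt ?D = Tgt C"
    by (simp_all add: full_subcat_def)
  have arr: "f \<in> Arr ?D \<longleftrightarrow> f \<in> Arr C \<and> S (Src C f) \<and> S (Tgt C f)"
      "A \<in> Obj ?D \<longleftrightarrow> A \<in> Obj C \<and> S A" for f A
    by (simp_all add: full_subcat_def)
  show ?thesis
    by (rule category.intro) (simp_all add: sub ops arr)
qed

lemma category_slice:
  assumes "category C"
  shows "category (slice C B)"
proof -
  interpret category C by fact
  let ?D = "slice C B"
  have hom: "x \<in> Hom ?D f g \<longleftrightarrow> (\<exists>k. x = (f, k, g) \<and> f \<in> Arr C \<and> Tgt C f = B \<and> g \<in> Arr C \<and> Tgt C g = B \<and>
      k \<in> Hom C (Src C f) (Src C g) \<and> g \<cdot>\<^bsub>C\<^esub> k = f)" for x f g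
    by (auto simp: slice_def Hom_def)
  have ops: "(g, l, h) \<cdot>\<^bsub>?D\<^esub> (f, k, g') = (f, l \<cdot>\<^bsub>C\<^esub> k, h)" "Idn ?D f = (f, Idn C (Src C f), f)"
      "f \<in> Obj ?D \<longleftrightarrow> f \<in> Arr C \<and> Tgt C f = B" for f g h k l g'
    by (simp_all add: slice_def)
  show ?thesis
  proof (rule category.intro)
    fix x y f g h assume "x \<in> Hom ?D f g" "y \<in> Hom ?D g h"
    then obtain k l where x: "x = (f, k, g)" and y: "y = (g, l, h)"
      and [simp]: "f \<in> Arr C" "Tgt C f = B" "g \<in> Arr C" "Tgt C g = B" "h \<in> Arr C" "Tgt C h = B"
        "k \<in> Arr C" "Src C k = Src C f" "Tgt C k = Src C g" "l \<in> Arr C" "Src C l = Src C g" "Tgt C l = Src C h"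
      and c: "g \<cdot>\<^bsub>C\<^esub> k = f" "h \<cdot>\<^bsub>C\<^esub> l = g"
      unfolding hom hom_iff by blast
    have "h \<cdot>\<^bsub>C\<^esub> (l \<cdot>\<^bsub>C\<^esub> k) = f" using Cmp_reduce[OF c(2), of k] c(1) by simp
    then show "y \<cdot>\<^bsub>?D\<^esub> x \<in> Hom ?D f h" unfolding x y ops hom by simp
  next
    fix x y z f g h j assume "x \<in> Hom ?D f g" "y \<in> Hom ?D g h" "z \<in> Hom ?D h j"
    then show "(z \<cdot>\<^bsub>?D\<^esub> y) \<cdot>\<^bsub>?D\<^esub> x = z \<cdot>\<^bsub>?D\<^esub> (y \<cdot>\<^bsub>?D\<^esub> x)"
      unfolding hom by (elim exE) (simp add: ops)
  next
    fix x f g assume "x \<in> Hom ?D f g"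
    then show "Idn ?D g \<cdot>\<^bsub>?D\<^esub> x = x" "x \<cdot>\<^bsub>?D\<^esub> Idn ?D f = x"
      unfolding hom by (elim exE; simp add: ops)+
  next
    fix f assume "f \<in> Obj ?D"
    then show "Idn ?D f \<in> Hom ?D f f" unfolding hom ops by simp
  next
    fix x assume "x \<in> Arr ?D"
    then show "Src ?D x \<in> Obj ?D" "Tgt ?D x \<in> Obj ?D" by (auto simp: slice_def)
  qed
qed

lemma Hom_class_slice:
  "Hom (class_slice C E B) f g =
    {(f, k, g) | k. f \<in> Arr C \<and> Tgt C f = B \<and> E f \<and> g \<in> Arr C \<and> Tgt C g = B \<and> E g \<and>
       k \<in> Hom C (Src C f) (Src C g) \<and> g \<cdot>\<^bsub>C\<^esub> k = f}"
  by (auto simp: class_slice_def full_subcat_def slice_def Hom_def)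

lemma Obj_class_slice: "Obj (class_slice C E B) = {f \<in> Arr C. Tgt C f = B \<and> E f}"
  by (auto simp: class_slice_def full_subcat_def slice_def)

lemma category_class_slice: "category C \<Longrightarrow> category (class_slice C E B)"
  unfolding class_slice_def by (intro category_full_subcat category_slice)

lemma class_slice_ops:
  "Idn (class_slice C E B) f = (f, Idn C (Src C f), f)"
  "(g, l, h) \<cdot>\<^bsub>class_slice C E B\<^esub> (f, k, g') = (f, l \<cdot>\<^bsub>C\<^esub> k, h)"
  by (simp_all add: class_slice_def full_subcat_def slice_def)

context unital_category
begin

lemma Ab_simps [simp]:
  "Src (Ab C) = Src C" "Tgt (Ab C) = Tgt C" "Cmp (Ab C) = Cmp C" "Idn (Ab C) = Idn C"
  by (simp_all add: Ab_def full_subcat_def)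

lemma Ab_Obj: "A \<in> Obj (Ab C) \<longleftrightarrow> abelian A"
  by (auto simp: Ab_def full_subcat_def abelian_object_iff)

lemma Ab_Arr: "f \<in> Arr (Ab C) \<longleftrightarrow> f \<in> Arr C \<and> abelian (Src C f) \<and> abelian (Tgt C f)"
  by (simp add: Ab_def full_subcat_def abelian_object_iff)

lemma Ab_Hom: "f \<in> Hom (Ab C) A B \<longleftrightarrow> f \<in> Hom C A B \<and> abelian A \<and> abelian B"
  by (auto simp: Hom_def[of "Ab C"] Ab_Arr)

lemma category_Ab: "category (Ab C)"
  unfolding Ab_def by (intro category_full_subcat category_axioms)

end

context cocomplete_regular_unital_category
begin

text \<open>
  The coequalizer g in C of the pair that f coequalizes is a regular quotient of an abelian object,
  hence abelian. So g has the universal property of f in the abelian core, and f is isomorphic to g.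
\<close>

lemma regular_epi_if_regular_epi_Ab:
  assumes f: "regular_epi (Ab C) f"
  shows "regular_epi C f"
proof -
  interpret A: category "Ab C" by (rule category_Ab)
  obtain u v where c: "is_coequalizer (Ab C) u v f" using f unfolding regular_epi_def by blast
  note cD = A.coequalizerD[OF c, unfolded Ab_Arr Ab_simps]
  have [simp]: "u \<in> Arr C" "v \<in> Arr C" "f \<in> Arr C" "Src C v = Src C u" "Tgt C v = Tgt C u"
    "Src C f = Tgt C u" "abelian (Src C u)" "abelian (Tgt C u)" "abelian (Tgt C f)"
    using cD(1-6) by simp_all
  obtain g where g: "is_coequalizer C u v g"
    using coequalizer_exists[OF cocomplete, of u "Src C u" "Tgt C u" v] by auto
  then have re: "regular_epi C g" unfolding regular_epi_def by blast
  note gD = coequalizerD[OF g]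
  note [simp] = gD(3,6)
  have [simp]: "abelian (Tgt C g)" by (rule quotient_abelian[OF re, of "Tgt C u"]) simp_all
  obtain s where s: "s \<in> Hom C (Tgt C g) (Tgt C f)" "s \<cdot> g = f"
    by (rule coequalizer_lift[OF g _ cD(7), of "Tgt C f"]) simp_all
  obtain t where t: "t \<in> Hom (Ab C) (Tgt C f) (Tgt C g)" "t \<cdot> f = g"
  proof (rule A.coequalizer_lift[OF c, unfolded Ab_simps])
    show "g \<in> Hom (Ab C) (Tgt C u) (Tgt C g)" by (simp add: Ab_Arr)
    show "g \<cdot> u = g \<cdot> v" by (rule gD(7))
  qed
  have [simp]: "t \<in> Arr C" "Src C t = Tgt C f" "Tgt C t = Tgt C g" using t(1) by (simp_all add: Ab_Arr)
  note [simp] = HomD(1-3)[OF s(1)]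
  have "s \<cdot> t = Idn C (Tgt C f)"
  proof (rule A.regular_epi_cancel[OF f, unfolded Ab_simps])
    show "(s \<cdot> t) \<cdot> f = Idn C (Tgt C f) \<cdot> f" using s(2) t(2) by simp
  qed (simp_all add: Ab_Arr)
  moreover have "t \<cdot> s = Idn C (Tgt C g)"
    by (rule regular_epi_cancel[OF re]) (use s(2) t(2) in simp_all)
  ultimately have "regular_epi C (s \<cdot> g)"
    by (intro regular_epi_iso_Cmp[OF re s(1), of t]) simp_all
  then show ?thesis using s(2) by simp
qed

lemma ab_unit_if_reflection:
  assumes F: "is_reflection C (Ab C) F \<eta>" and B: "B \<in> Obj C"
  shows "ab_unit B (FObj F B) (\<eta> B)"
proof -
  note F = F[unfolded is_reflection_def]
  note fctr = conjunct1[OF F] and unit = conjunct1[OF conjunct2[OF F]]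
    and univ = conjunct2[OF conjunct2[OF conjunct2[OF F]]]
  have "\<forall>A \<in> Obj C. FObj F A \<in> Obj (Ab C)" using fctr unfolding is_functor_def by (elim conjE)
  then have A: "abelian (FObj F B)" using B by (simp add: Ab_Obj)
  have "\<exists>!k. k \<in> Hom C (FObj F B) D \<and> k \<cdot> \<eta> B = h" if D: "abelian D" "h \<in> Hom C B D" for D h
    using bspec[OF bspec[OF bspec[OF univ B], of D] D(2)] A D(1)
    by (simp only: Ab_Hom Ab_Obj simp_thms)
  then show ?thesis using A bspec[OF unit B] unfolding ab_unit_def by (intro conjI allI impI)
qed

lemma reflection_exists: "\<exists>F \<eta>. is_reflection C (Ab C) F \<eta>"
proof -
  have "\<forall>X \<in> Obj C. \<exists>A\<eta>. ab_unit X (fst A\<eta>) (snd A\<eta>)"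
  proof
    fix X assume "X \<in> Obj C"
    then obtain A \<eta> where "ab_unit X A \<eta>" by (rule ab_unit_exists)
    then show "\<exists>A\<eta>. ab_unit X (fst A\<eta>) (snd A\<eta>)" by (intro exI[of _ "(A, \<eta>)"]) simp
  qed
  from bchoice[OF this] obtain r where r: "\<forall>X \<in> Obj C. ab_unit X (fst (r X)) (snd (r X))" by blast
  define R where "R = (\<lambda>X. fst (r X))"
  define \<eta> where "\<eta> = (\<lambda>X. snd (r X))"
  have u: "ab_unit X (R X) (\<eta> X)" if "X \<in> Obj C" for X using r that by (simp add: R_def \<eta>_def)
  define M where "M = (\<lambda>f. THE k. k \<in> Hom C (R (Src C f)) (R (Tgt C f)) \<and> k \<cdot> \<eta> (Src C f) = \<eta> (Tgt C f) \<cdot> f)"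
  note uD [simp] = ab_unitD(1-4)[OF u]
  have M: "M f \<in> Hom C (R A) (R B)" "M f \<cdot> \<eta> A = \<eta> B \<cdot> f"
    and Muniq: "\<And>k. k \<in> Hom C (R A) (R B) \<Longrightarrow> k \<cdot> \<eta> A = \<eta> B \<cdot> f \<Longrightarrow> M f = k"
    if f: "f \<in> Hom C A B" for f A B
  proof -
    note [simp] = HomD[OF f]
    have "\<eta> B \<cdot> f \<in> Hom C A (R B)" "abelian (R B)" by simp_all
    then have ex: "\<exists>!k. k \<in> Hom C (R A) (R B) \<and> k \<cdot> \<eta> A = \<eta> B \<cdot> f"
      using u[of A] HomD(4)[OF f] unfolding ab_unit_def by blast
    have Mf: "M f = (THE k. k \<in> Hom C (R A) (R B) \<and> k \<cdot> \<eta> A = \<eta> B \<cdot> f)"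
      unfolding M_def HomD(2,3)[OF f] ..
    from theI'[OF ex] show "M f \<in> Hom C (R A) (R B)" "M f \<cdot> \<eta> A = \<eta> B \<cdot> f"
      unfolding Mf by blast+
    show "M f = k" if "k \<in> Hom C (R A) (R B)" "k \<cdot> \<eta> A = \<eta> B \<cdot> f" for k
      unfolding Mf using that by (intro the1_equality[OF ex]) blast
  qed
  have "is_functor C (Ab C) \<lparr>FObj = R, FArr = M\<rparr>"
    unfolding is_functor_def Ab_Hom Ab_Obj Ab_simps func.simps
  proof (intro conjI ballI category_axioms category_Ab)
    fix A assume A: "A \<in> Obj C"
    then show "abelian (R A)" by simp
    show "M (Idn C A) = Idn C (R A)" by (rule Muniq[of _ A A]) (use A in simp_all)
    fix B f assume B: "B \<in> Obj C" and f: "f \<in> Hom C A B"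
    show "M f \<in> Hom C (R A) (R B)" by (rule M(1)[OF f])
    show "abelian (R B)" using B by simp
    fix E g assume E: "E \<in> Obj C" and g: "g \<in> Hom C B E"
    note [simp] = HomD[OF f] HomD[OF g] HomD(1-3)[OF M(1)[OF f]] HomD(1-3)[OF M(1)[OF g]]
    show "M (g \<cdot> f) = M g \<cdot> M f"
    proof (rule Muniq[of _ A E])
      show "(M g \<cdot> M f) \<cdot> \<eta> A = \<eta> E \<cdot> (g \<cdot> f)"
        using M(2)[OF f] Cmp_reduce[OF M(2)[OF g], of f] by simp
    qed simp_all
  qed simp
  moreover have "\<exists>!k. k \<in> Hom (Ab C) (R B) A \<and> k \<cdot> \<eta> B = h"
    if B: "B \<in> Obj C" "abelian A" "h \<in> Hom C B A" for A B h
  proof -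
    have "\<forall>D h. abelian D \<longrightarrow> h \<in> Hom C B D \<longrightarrow> (\<exists>!k. k \<in> Hom C (R B) D \<and> k \<cdot> \<eta> B = h)"
      using u[OF B(1)] unfolding ab_unit_def by (elim conjE)
    then have "\<exists>!k. k \<in> Hom C (R B) A \<and> k \<cdot> \<eta> B = h" using B(2,3) by blast
    then show ?thesis using B(2) uD(1)[OF B(1)] by (simp only: Ab_Hom simp_thms)
  qed
  moreover have "\<eta> B \<in> Hom C B (R B)" if "B \<in> Obj C" for B using that by simp
  ultimately have "is_reflection C (Ab C) \<lparr>FObj = R, FArr = M\<rparr> \<eta>"
    unfolding is_reflection_def Ab_Obj func.simps by (intro conjI ballI M(2)) (simp_all only: Ab_Obj)
  then show ?thesis by blast
qed

end

section \<open>The pullback functor\<close>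

context exact_unital_category
begin

context
  fixes B T :: 'o and \<eta> :: 'm and p q :: "'m \<Rightarrow> 'm"
  assumes \<eta>: "ab_unit B T \<eta>"
    and pb: "\<And>f. f \<in> Obj (class_slice (Ab C) (regular_epi (Ab C)) T) \<Longrightarrow>
      is_pullback C \<eta> f (p f) (q f)"
begin

private abbreviation "S \<equiv> class_slice (Ab C) (regular_epi (Ab C)) T"
private abbreviation "S' \<equiv> class_slice C (regular_epi C) B"

private lemma S_objD:
  assumes "f \<in> Obj S"
  shows "f \<in> Arr C" "Tgt C f = T" "abelian (Src C f)" "regular_epi C f"
    "p f \<in> Arr C" "Tgt C (p f) = B" "q f \<in> Arr C" "Src C (q f) = Src C (p f)" "Tgt C (q f) = Src C f"
    "f \<cdot> q f = \<eta> \<cdot> p f" "regular_epi C (p f)" "ab_unit (Src C (p f)) (Src C f) (q f)"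
proof -
  show f: "f \<in> Arr C" "Tgt C f = T" "abelian (Src C f)" "regular_epi C f"
    using assms regular_epi_if_regular_epi_Ab[of f] by (simp_all add: Obj_class_slice Ab_Arr)
  show "p f \<in> Arr C" "Tgt C (p f) = B" "q f \<in> Arr C" "Src C (q f) = Src C (p f)" "Tgt C (q f) = Src C f"
    "f \<cdot> q f = \<eta> \<cdot> p f"
    using pullbackD(3,4,6-9)[OF pb[OF assms]] ab_unitD[OF \<eta>] by simp_all
  show "regular_epi C (p f)" by (rule regular_epi_pullback[OF pb[OF assms] f(4)])
  show "ab_unit (Src C (p f)) (Src C f) (q f)"
    by (rule pullback_of_unit_is_unit[OF \<eta> _ f(4,3) pb[OF assms]]) (use f in simp)
qed

text \<open>
  The arrow between pullbacks that the pullback functor assigns to k.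
\<close>

private definition base_change :: "'m \<Rightarrow> 'm \<Rightarrow> 'm \<Rightarrow> 'm" where
  "base_change f k g = (THE u. u \<in> Hom C (Src C (p f)) (Src C (p g)) \<and>
     p g \<cdot> u = p f \<and> q g \<cdot> u = k \<cdot> q f)"

private lemma base_change:
  assumes f: "f \<in> Obj S" and g: "g \<in> Obj S" and k: "k \<in> Hom C (Src C f) (Src C g)" "g \<cdot> k = f"
  shows "base_change f k g \<in> Hom C (Src C (p f)) (Src C (p g))" (is ?typ)
    "p g \<cdot> base_change f k g = p f" (is ?p)
    "q g \<cdot> base_change f k g = k \<cdot> q f" (is ?q)
    "u \<in> Hom C (Src C (p f)) (Src C (p g)) \<Longrightarrow> p g \<cdot> u = p f \<Longrightarrow> q g \<cdot> u = k \<cdot> q f \<Longrightarrow>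
       base_change f k g = u"
proof -
  note [simp] = S_objD(1-3,5-9)[OF f] S_objD(1-3,5-9)[OF g] ab_unitD[OF \<eta>] HomD(1-3)[OF k(1)]
  obtain w where w: "w \<in> Hom C (Src C (p f)) (Src C (p g))" "p g \<cdot> w = p f" "q g \<cdot> w = k \<cdot> q f"
  proof (rule pullback_lift[OF pb[OF g], of "p f" "Src C (p f)" "k \<cdot> q f"])
    show "\<eta> \<cdot> p f = g \<cdot> (k \<cdot> q f)"
      using Cmp_reduce[OF k(2), of "q f"] S_objD(10)[OF f] by simp
  qed simp_all
  have uniq: "u = w" if "u \<in> Hom C (Src C (p f)) (Src C (p g))" "p g \<cdot> u = p f" "q g \<cdot> u = k \<cdot> q f" for u
    by (rule pullback_ext[OF pb[OF g] that(1) w(1)]) (simp_all only: that w)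
  have bw: "base_change f k g = w"
    unfolding base_change_def by (rule the_equality) (use w uniq in blast)+
  show ?typ ?p ?q unfolding bw by (fact w)+
  show "base_change f k g = u"
    if "u \<in> Hom C (Src C (p f)) (Src C (p g))" "p g \<cdot> u = p f" "q g \<cdot> u = k \<cdot> q f"
    unfolding bw using uniq[OF that] by simp
qed

private lemma FArr_pullback_functor: "FArr (pullback_functor C p q) (f, k, g) = (p f, base_change f k g, p g)"
  by (simp add: pullback_functor_def base_change_def)

private lemma FObj_pullback_functor: "FObj (pullback_functor C p q) = p"
  by (simp add: pullback_functor_def)

private lemma S_Hom:
  assumes "f \<in> Obj S" "g \<in> Obj S"
  shows "Hom S f g = {(f, k, g) | k. k \<in> Hom C (Src C f) (Src C g) \<and> g \<cdot> k = f}"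
proof -
  have "f \<in> Arr (Ab C)" "Tgt C f = T" "regular_epi (Ab C) f" "g \<in> Arr (Ab C)" "Tgt C g = T" "regular_epi (Ab C) g"
    using assms by (simp_all add: Obj_class_slice)
  then show ?thesis
    using S_objD(3)[OF assms(1)] S_objD(3)[OF assms(2)]
    unfolding Hom_class_slice Ab_Hom Ab_simps by blast
qed

private lemma S'_Hom:
  assumes "f \<in> Obj S" "g \<in> Obj S"
  shows "Hom S' (p f) (p g) =
    {(p f, u, p g) | u. u \<in> Hom C (Src C (p f)) (Src C (p g)) \<and> p g \<cdot> u = p f}"
  using S_objD(5,6,11)[OF assms(1)] S_objD(5,6,11)[OF assms(2)]
  unfolding Hom_class_slice by blast

private lemma pullback_is_functor: "is_functor S S' (pullback_functor C p q)"
  unfolding is_functor_def FObj_pullback_functor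
proof (intro conjI ballI)
  show "category S" "category S'"
    by (intro category_class_slice category_Ab category_axioms)+
  fix f assume f: "f \<in> Obj S"
  note [simp] = S_objD(1-9)[OF f]
  show "p f \<in> Obj S'" using S_objD(11)[OF f] by (simp add: Obj_class_slice)
  have "base_change f (Idn C (Src C f)) f = Idn C (Src C (p f))"
    by (rule base_change(4)[OF f f]) simp_all
  then show "FArr (pullback_functor C p q) (Idn S f) = Idn S' (p f)"
    by (simp add: class_slice_ops FArr_pullback_functor)
  fix g assume g: "g \<in> Obj S"
  note [simp] = S_objD(1-9)[OF g]
  fix x assume "x \<in> Hom S f g"
  then obtain k where x: "x = (f, k, g)" and k: "k \<in> Hom C (Src C f) (Src C g)" "g \<cdot> k = f"
    unfolding S_Hom[OF f g] by blast
  note [simp] = HomD(1-3)[OF k(1)]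
  note bk = base_change[OF f g k]
  show "FArr (pullback_functor C p q) x \<in> Hom S' (p f) (p g)"
    unfolding x FArr_pullback_functor S'_Hom[OF f g] using bk(1,2) by blast
  fix h assume h: "h \<in> Obj S"
  note [simp] = S_objD(1-9)[OF h]
  fix y assume "y \<in> Hom S g h"
  then obtain l where y: "y = (g, l, h)" and l: "l \<in> Hom C (Src C g) (Src C h)" "h \<cdot> l = g"
    unfolding S_Hom[OF g h] by blast
  note [simp] = HomD(1-3)[OF l(1)]
  note bl = base_change[OF g h l]
  note [simp] = HomD(1-3)[OF bk(1)] HomD(1-3)[OF bl(1)]
  have "base_change f (l \<cdot> k) h = base_change g l h \<cdot> base_change f k g"
  proof (rule base_change(4)[OF f h])
    show "h \<cdot> (l \<cdot> k) = f" using Cmp_reduce[OF l(2), of k] k(2) by simp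
    show "p h \<cdot> (base_change g l h \<cdot> base_change f k g) = p f"
      using Cmp_reduce[OF bl(2), of "base_change f k g"] bk(2) by simp
    show "q h \<cdot> (base_change g l h \<cdot> base_change f k g) = (l \<cdot> k) \<cdot> q f"
      using Cmp_reduce[OF bl(3), of "base_change f k g"] bk(3) by simp
  qed simp_all
  then show "FArr (pullback_functor C p q) (y \<cdot>\<^bsub>S\<^esub> x) =
      FArr (pullback_functor C p q) y \<cdot>\<^bsub>S'\<^esub> FArr (pullback_functor C p q) x"
    unfolding x y by (simp add: class_slice_ops FArr_pullback_functor)
qed

text \<open>
  An arrow u between pullbacks is the base change of k exactly when k after q f equals q g after u.
  As q f is a reflection unit, this equation has exactly one solution k, and that k is an arrow over T
  because this too can be tested after q f.
\<close>

lemma pullback_functor_full_faithful: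
  "full_functor S S' (pullback_functor C p q) \<and> faithful_functor S S' (pullback_functor C p q)"
  unfolding full_functor_def faithful_functor_def FObj_pullback_functor
proof (intro conjI ballI pullback_is_functor)
  fix f g assume f: "f \<in> Obj S" and g: "g \<in> Obj S"
  note [simp] = S_objD(1-3,5-9)[OF f] S_objD(1-3,5-9)[OF g] ab_unitD[OF \<eta>]
  note unit = S_objD(12)[OF f]
  show "FArr (pullback_functor C p q) ` Hom S f g = Hom S' (p f) (p g)"
  proof (intro equalityI subsetI)
    fix z assume "z \<in> FArr (pullback_functor C p q) ` Hom S f g"
    then obtain k where z: "z = FArr (pullback_functor C p q) (f, k, g)"
        and k: "k \<in> Hom C (Src C f) (Src C g)" "g \<cdot> k = f"
      unfolding S_Hom[OF f g] by blast
    show "z \<in> Hom S' (p f) (p g)"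
      unfolding z FArr_pullback_functor S'_Hom[OF f g] using base_change(1,2)[OF f g k] by blast
  next
    fix z assume "z \<in> Hom S' (p f) (p g)"
    then obtain u where z: "z = (p f, u, p g)" and u: "u \<in> Hom C (Src C (p f)) (Src C (p g))" "p g \<cdot> u = p f"
      unfolding S'_Hom[OF f g] by blast
    note [simp] = HomD(1-3)[OF u(1)]
    obtain k where k: "k \<in> Hom C (Src C f) (Src C g)" "k \<cdot> q f = q g \<cdot> u"
      by (rule ab_unit_lift[OF unit, of "Src C g" "q g \<cdot> u"]) simp_all
    note [simp] = HomD(1-3)[OF k(1)]
    have gk: "g \<cdot> k = f"
    proof (rule ab_unit_cancel[OF unit, of T])
      have "(g \<cdot> k) \<cdot> q f = (g \<cdot> q g) \<cdot> u" using k(2) by simp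
      also have "\<dots> = \<eta> \<cdot> (p g \<cdot> u)" unfolding S_objD(10)[OF g] by simp
      also have "\<dots> = f \<cdot> q f" unfolding u(2) S_objD(10)[OF f] ..
      finally show "(g \<cdot> k) \<cdot> q f = f \<cdot> q f" .
    qed simp_all
    have "FArr (pullback_functor C p q) (f, k, g) = z"
      unfolding FArr_pullback_functor z using base_change(4)[OF f g k(1) gk u k(2)[symmetric]] by simp
    moreover have "(f, k, g) \<in> Hom S f g" unfolding S_Hom[OF f g] using k(1) gk by blast
    ultimately show "z \<in> FArr (pullback_functor C p q) ` Hom S f g" by (metis image_eqI)
  qed
  show "inj_on (FArr (pullback_functor C p q)) (Hom S f g)"
  proof (rule inj_onI)
    fix x y assume xy: "x \<in> Hom S f g" "y \<in> Hom S f g"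
      and eq: "FArr (pullback_functor C p q) x = FArr (pullback_functor C p q) y"
    obtain k where x: "x = (f, k, g)" and k: "k \<in> Hom C (Src C f) (Src C g)" "g \<cdot> k = f"
      using xy(1) unfolding S_Hom[OF f g] by blast
    obtain l where y: "y = (f, l, g)" and l: "l \<in> Hom C (Src C f) (Src C g)" "g \<cdot> l = f"
      using xy(2) unfolding S_Hom[OF f g] by blast
    have "base_change f k g = base_change f l g" using eq unfolding x y FArr_pullback_functor by simp
    then have "k \<cdot> q f = l \<cdot> q f" using base_change(3)[OF f g k] base_change(3)[OF f g l] by simp
    then have "k = l" by (rule ab_unit_cancel[OF unit _ k(1) l(1), rotated -1]) simp
    then show "x = y" using x y by simp
  qed
qed

end

end

theorem theorem6p3:
  fixes C :: "('o, 'm) cat"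
  assumes "unital C"
    and "barr_exact C"
    and "finitely_cocomplete C"
  shows "(\<exists>ab \<eta>. is_reflection C (Ab C) ab \<eta>) \<and>
         (\<forall>ab \<eta>. is_reflection C (Ab C) ab \<eta> \<longrightarrow> admissible (Gamma_Ab C ab \<eta>))"
proof -
  interpret category C using assms(3) by (simp add: finitely_cocomplete_def)
  interpret exact_unital_category C
    by unfold_locales (use assms in \<open>simp_all add: barr_exact_def\<close>)
  show ?thesis
  proof (intro conjI allI impI reflection_exists)
    fix ab \<eta> assume refl: "is_reflection C (Ab C) ab \<eta>"
    show "admissible (Gamma_Ab C ab \<eta>)"
      unfolding admissible_def Gamma_Ab_def Let_def galois_data.simps
      by (intro ballI allI impI pullback_functor_full_faithful[OF ab_unit_if_reflection[OF refl]]) blast+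
  qed
qed

end
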